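(* Assume the low-noise condition (LN) holds for some $c>0$. Let $X^*\in\mathbb{R}^{m_1\times m_2}$ satisfy $\|X^*\|_\infty\le\gamma$ and let $r=\operatorname{rank}(X^* )$. Let $\hat X^{(2)}\in\arg\max_{X\in K_{\max}(\gamma,r)}\ell_{\Omega,Y}(X)$ and $\hat\eta(\omega)=\operatorname{sign}(\hat X^{(2)}_\omega)$. Then $$\mathrm{excess}(\hat\eta,\eta^* )\le C_\gamma\sqrt{\frac{\operatorname{rank}(X^* )\,d}{n}},$$ where $C_\gamma>0$ is a constant depending only on $\gamma$ (and on the low-noise constant $c$).
   Context: Setup (1-bit matrix completion with logistic link). Let $m_1,m_2\ge1$, $d=m_1+m_2$, and let $f(x)=e^x/(1+e^x)$. An unknown matrix $X^*\in\mathbb{R}^{m_1\times m_2}$ is given. Indices $\omega_1,\dots,\omega_n$ are i.i.d. uniform on $[m_1]\times[m_2]$ (where $[k]=\{1,\dots,k\}$), $\Omega=(\omega_i)_{i=1}^n$, and, conditionally on the indices, the labels $Y_1,\dots,Y_n\in\{-1,1\}$ are independent with $Y_i=+1$ with probability $f(X^*_{\omega_i})$ and $Y_i=-1$ with probability $1-f(X^*_{\omega_i})$. The sample is $\mathcal S=\{(Y_i,\omega_i)\}_{i=1}^n$. Log-likelihood: $\ell_{\Omega,Y}(X)=\sum_{i=1}^n\big(\mathbf 1\{Y_i=1\}\log f(X_{\omega_i})+\mathbf 1\{Y_i=-1\}\log(1-f(X_{\omega_i}))\big)$. Norms: $\|X\|_\infty=\max_{i,j}|X_{ij}|$; $\|U\|_{2,\infty}$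 is the maximum Euclidean norm of the rows of $U$; the max-norm is $\|X\|_{\max}=\min_{X=UV^\top}\|U\|_{2,\infty}\|V\|_{2,\infty}$. For $\gamma,r>0$, $K_{\max}(\gamma,r)=\{X\in\mathbb{R}^{m_1\times m_2}:\|X\|_\infty\le\gamma,\ \|X\|_{\max}\le\gamma\sqrt r\}$. Classification risk: for a (possibly data-dependent) classifier $\eta:[m_1]\times[m_2]\to\{-1,1\}$, let $(Y,\omega)$ be a new pair independent of $\mathcal S$ with $\omega$ uniform on $[m_1]\times[m_2]$ and $Y\mid\omega$ equal to $+1$ with probability $f(X^*_\omega)$ and $-1$ otherwise; $R(\eta)=\mathbb P(Y\ne\eta(\omega)\mid\mathcal S)$. The Bayes classifier is $\eta^*(\omega)=\operatorname{sign}(X^*_\omega)$ (i.e. $+1$ iff $f(X^*_\omega)\ge1/2$, with $\operatorname{sign}(0)=+1$). For an estimator $\hat X$ the plug-in classifier is $\hat\eta(\omega)=\operatorname{sign}(\hat X_\omega)$ and $\mathrm{excess}(\hat\eta,\eta^* )=\mathbb E\,R(\hat\eta)-R(\eta^* )$, the expectation being over $\mathcal S$. Low-noise condition (LN): for some $c>0$, with $\omega$ uniform on $[m_1]\times[m_2]$, $\mathbb P\big(0<|f(X^*_\omega)-\tfrac12|<\tfrac1{2c}\big)=0$. *)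

theory Defs
  imports "HOL-Probability.Probability_Mass_Function" "Jordan_Normal_Form.DL_Rank"
begin

text \<open>Matrices are Jordan_Normal_Form matrices (type real mat); indices are 0-based,
  i.e. the index set [m1] x [m2] is rendered as {0..<m1} x {0..<m2}.\<close>

definition logistic :: "real \<Rightarrow> real" where
  "logistic x = exp x / (1 + exp x)"

definition idx_set :: "nat \<Rightarrow> nat \<Rightarrow> (nat \<times> nat) set" where
  "idx_set m1 m2 = {0..<m1} \<times> {0..<m2}"

definition sup_norm :: "real mat \<Rightarrow> real" where
  "sup_norm X = Max ({\<bar>X $$ (i, j)\<bar> | i j. i < dim_row X \<and> j < dim_col X} \<union> {0})"

definition two_inf_norm :: "real mat \<Rightarrow> real" where
  "two_inf_norm U = Max ({sqrt (\<Sum>j<dim_col U. (U $$ (i, j))\<^sup>2) | i. i < dim_row U} \<union> {0})"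

definition max_norm :: "real mat \<Rightarrow> real" where
  "max_norm X = Inf {two_inf_norm U * two_inf_norm V | U V k.
      U \<in> carrier_mat (dim_row X) k \<and> V \<in> carrier_mat (dim_col X) k \<and> X = U * transpose_mat V}"

definition K_max :: "real \<Rightarrow> real \<Rightarrow> nat \<Rightarrow> nat \<Rightarrow> real mat set" where
  "K_max \<gamma> r m1 m2 = {X \<in> carrier_mat m1 m2. sup_norm X \<le> \<gamma> \<and> max_norm X \<le> \<gamma> * sqrt r}"

text \<open>A sample is a list of pairs (Y_i, omega_i) with Y_i in {-1,1}.\<close>
definition loglik :: "real mat \<Rightarrow> (int \<times> (nat \<times> nat)) list \<Rightarrow> real" where
  "loglik X S = (\<Sum>(y, w) \<leftarrow> S. (if y = 1 then ln (logistic (X $$ w)) else 0)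
                                 + (if y = -1 then ln (1 - logistic (X $$ w)) else 0))"

definition obs_pmf :: "nat \<Rightarrow> nat \<Rightarrow> real mat \<Rightarrow> (int \<times> (nat \<times> nat)) pmf" where
  "obs_pmf m1 m2 Xs =
     do { w \<leftarrow> pmf_of_set (idx_set m1 m2);
          b \<leftarrow> bernoulli_pmf (logistic (Xs $$ w));
          return_pmf (if b then 1 else -1, w) }"

definition sample_pmf :: "nat \<Rightarrow> nat \<Rightarrow> nat \<Rightarrow> real mat \<Rightarrow> (int \<times> (nat \<times> nat)) list pmf" where
  "sample_pmf m1 m2 n Xs = replicate_pmf n (obs_pmf m1 m2 Xs)"

definition sign_pm :: "real \<Rightarrow> int" where
  "sign_pm x = (if x \<ge> 0 then 1 else -1)"

definition risk :: "nat \<Rightarrow> nat \<Rightarrow> real mat \<Rightarrow> (nat \<times> nat \<Rightarrow> int) \<Rightarrow> real" where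
  "risk m1 m2 Xs eta = measure_pmf.prob (obs_pmf m1 m2 Xs) {(y, w). y \<noteq> eta w}"

definition excess_risk :: "nat \<Rightarrow> nat \<Rightarrow> nat \<Rightarrow> real mat \<Rightarrow> ((int \<times> (nat \<times> nat)) list \<Rightarrow> real mat) \<Rightarrow> real" where
  "excess_risk m1 m2 n Xs Xhat =
     measure_pmf.expectation (sample_pmf m1 m2 n Xs)
        (\<lambda>S. risk m1 m2 Xs (\<lambda>w. sign_pm (Xhat S $$ w)))
     - risk m1 m2 Xs (\<lambda>w. sign_pm (Xs $$ w))"

definition low_noise :: "real \<Rightarrow> nat \<Rightarrow> nat \<Rightarrow> real mat \<Rightarrow> bool" where
  "low_noise c m1 m2 Xs \<longleftrightarrow>
     measure_pmf.prob (pmf_of_set (idx_set m1 m2))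
       {w. 0 < \<bar>logistic (Xs $$ w) - 1/2\<bar> \<and> \<bar>logistic (Xs $$ w) - 1/2\<bar> < 1 / (2 * c)} = 0"

definition matrix_rank :: "real mat \<Rightarrow> nat" where
  "matrix_rank X = vec_space.rank (dim_row X) X"

end

theory Submission
  imports Defs
begin

text \<open>Under the low-noise condition a wrong sign forces a Kullback--Leibler loss proportional to the
  classification loss, so it suffices to bound the expected excess logistic loss of the maximum
  likelihood estimator. Since the true matrix satisfies \<open>max_norm Xs \<le> \<gamma> * sqrt (rank Xs)\<close>
  (a John-type bound, obtained here from a D-optimal design on the rows of a rank factorization), it
  competes in the optimisation, and the excess loss is dominated by a uniform deviation over the
  max-norm ball. Symmetrization and contraction reduce this deviation to a Rademacher process that
  is linear in the matrix; by Grothendieck's inequality its supremum over the ball is, up to a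
  constant, a maximum over the \<open>2 ^ (m1 + m2)\<close> sign matrices of rank one, which is of order
  \<open>sqrt (n * (m1 + m2))\<close>.\<close>

subsection \<open>Rank and max-norm\<close>

text \<open>\<open>K_max\<close> grants the radius \<open>\<gamma> * sqrt r\<close> with constant
  exactly 1, so a rank bound that loses a factor would not make the true matrix feasible; this is
  what calls for an optimal design. No localization is used: low noise makes the divergence at a
  wrong sign, quadratic in the distance of the label probability to 1/2, comparable to the
  classification loss, which is linear in it. The obstacle in the deviation is that the max-norm is
  an infimum over factorizations of unbounded width; the constant in Grothendieck's inequality does
  not depend on the width. All distributions have finite support, so only finitely many values of
  the estimator matter and suprema become maxima. The log-likelihood of one label is 1-Lipschitz on
  the whole line, so \<gamma> enters only through the radius. The final constant
  \<open>256 * c * \<gamma>\<close> is \<open>8 * c\<close> for passing from divergence to risk,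
  times 32, which rounds up 24: 2 from symmetrization, 8 from Grothendieck, 3/2 from the exponential
  moment bound.\<close>

lemma det_one_plus_rank_one:
  fixes u v :: "real vec"
  assumes u: "u \<in> carrier_vec n" and v: "v \<in> carrier_vec n"
  shows "det (1\<^sub>m n + mat n n (\<lambda>(i, j). u $ i * v $ j)) = 1 + u \<bullet> v"
proof -
  define U where "U = mat n 1 (\<lambda>(i, j). u $ i)"
  define V where "V = mat 1 n (\<lambda>(i, j). v $ j)"
  have U: "U \<in> carrier_mat n 1" and V: "V \<in> carrier_mat 1 n" by (auto simp: U_def V_def)
  have UV: "U * V = mat n n (\<lambda>(i, j). u $ i * v $ j)"
    by (rule eq_matI) (auto simp: U_def V_def scalar_prod_def)
  have VU: "V * U = mat 1 1 (\<lambda>_. u \<bullet> v)"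
    using u v by (intro eq_matI) (auto simp: U_def V_def scalar_prod_def mult.commute)
  \<comment> \<open>The matrix with blocks 1, \<open>- U\<close>, \<open>V\<close>, 1 is factored
    into block triangular matrices in two ways; equating determinants gives
    \<open>det (1 + U * V) = det (1 + V * U)\<close>, and the right side is 1 by 1.\<close>
  have "four_block_mat (1\<^sub>m n + U * V) (- U) (0\<^sub>m 1 n) (1\<^sub>m 1) * four_block_mat (1\<^sub>m n) (0\<^sub>m n 1) V (1\<^sub>m 1)
      = four_block_mat (1\<^sub>m n) (- U) V (1\<^sub>m 1)"
    by (subst mult_four_block_mat[where ?nr1.0 = n and ?n1.0 = n and ?n2.0 = 1 and ?nr2.0 = 1 and ?nc1.0 = n and ?nc2.0 = 1])
      (use U V in \<open>auto intro!: cong_four_block_mat eq_matI\<close>)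
  moreover have "four_block_mat (1\<^sub>m n) (0\<^sub>m n 1) V (1\<^sub>m 1) * four_block_mat (1\<^sub>m n) (- U) (0\<^sub>m 1 n) (1\<^sub>m 1 + V * U)
      = four_block_mat (1\<^sub>m n) (- U) V (1\<^sub>m 1)"
    by (subst mult_four_block_mat[where ?nr1.0 = n and ?n1.0 = n and ?n2.0 = 1 and ?nr2.0 = 1 and ?nc1.0 = n and ?nc2.0 = 1])
      (use U V in \<open>auto intro!: cong_four_block_mat eq_matI\<close>)
  ultimately have "det (four_block_mat (1\<^sub>m n + U * V) (- U) (0\<^sub>m 1 n) (1\<^sub>m 1) * four_block_mat (1\<^sub>m n) (0\<^sub>m n 1) V (1\<^sub>m 1))
      = det (four_block_mat (1\<^sub>m n) (0\<^sub>m n 1) V (1\<^sub>m 1) * four_block_mat (1\<^sub>m n) (- U) (0\<^sub>m 1 n) (1\<^sub>m 1 + V * U))"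
    by simp
  moreover have "four_block_mat (1\<^sub>m n + U * V) (- U) (0\<^sub>m 1 n) (1\<^sub>m 1) \<in> carrier_mat (n + 1) (n + 1)"
    "four_block_mat (1\<^sub>m n) (0\<^sub>m n 1) V (1\<^sub>m 1) \<in> carrier_mat (n + 1) (n + 1)"
    "four_block_mat (1\<^sub>m n) (- U) (0\<^sub>m 1 n) (1\<^sub>m 1 + V * U) \<in> carrier_mat (n + 1) (n + 1)"
    using U V by (auto intro!: four_block_carrier_mat)
  moreover have "det (four_block_mat (1\<^sub>m n + U * V) (- U) (0\<^sub>m 1 n) (1\<^sub>m 1)) = det (1\<^sub>m n + U * V)"
    by (subst det_four_block_mat_lower_left_zero[where n = n and m = 1]) (use U V in auto)
  moreover have "det (four_block_mat (1\<^sub>m n) (0\<^sub>m n 1) V (1\<^sub>m 1)) = 1"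
    by (subst det_four_block_mat_upper_right_zero[where n = n and m = 1]) (use U V in auto)
  moreover have "det (four_block_mat (1\<^sub>m n) (- U) (0\<^sub>m 1 n) (1\<^sub>m 1 + V * U)) = det (1\<^sub>m 1 + V * U)"
    by (subst det_four_block_mat_lower_left_zero[where n = n and m = 1]) (use U V in auto)
  moreover have "det (1\<^sub>m 1 + V * U) = 1 + u \<bullet> v"
    by (subst det_single) (auto simp: VU)
  ultimately show ?thesis by (simp add: det_mult[where n = "n + 1"] UV)
qed

text \<open>\<open>A\<close> collects a maximal independent set of columns of \<open>X\<close>:
  maximality puts every column in their span, hence \<open>B\<close>, and independence is the
  injectivity of \<open>A\<close>, which later makes a moment matrix invertible.\<close>

lemma rank_factorization:
  fixes X :: "real mat"
  assumes X: "X \<in> carrier_mat m k"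
  obtains A B where "A \<in> carrier_mat m (matrix_rank X)" "B \<in> carrier_mat (matrix_rank X) k" "X = A * B"
    "\<And>v. v \<in> carrier_vec (matrix_rank X) \<Longrightarrow> A *\<^sub>v v = 0\<^sub>v m \<Longrightarrow> v = 0\<^sub>v (matrix_rank X)"
proof -
  interpret vec_space "TYPE(real)" m .
  have colsX: "set (cols X) \<subseteq> carrier_vec m" using X cols_dim by blast
  obtain S where S: "maximal S (\<lambda>T. T \<subseteq> set (cols X) \<and> lin_indpt T)"
    using maximal_exists[of "(\<lambda>T. T \<subseteq> set (cols X) \<and> lin_indpt T)" "card (set (cols X))" "{}"]
    by (meson List.finite_set card_mono empty_iff empty_subsetI finite_lin_indpt2 rev_finite_subset)
  then have SX: "S \<subseteq> set (cols X)" and indS: "lin_indpt S" by (auto simp: maximal_def)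
  have finS: "finite S" using SX finite_subset by blast
  have Sc: "S \<subseteq> carrier_vec m" using SX colsX by blast
  define r where "r = matrix_rank X"
  have r: "r = card S"
    using rank_card_indpt[OF X S] X by (simp add: r_def matrix_rank_def)
  obtain vs where vs: "set vs = S" "distinct vs" using finite_distinct_list[OF finS] by blast
  have lenvs: "length vs = r" using vs r distinct_card by fastforce
  define A where "A = mat_of_cols m vs"
  have A: "A \<in> carrier_mat m r" by (simp add: A_def lenvs[symmetric])
  have colsA: "cols A = vs" unfolding A_def using vs Sc by (intro cols_mat_of_cols) auto
  have inspan: "x \<in> span S" if x: "x \<in> set (cols X)" for x
  proof (rule ccontr)
    assume "x \<notin> span S"
    then have xS: "x \<notin> S" using in_own_span[of S] Sc by auto
    then have "lin_indpt (insert x S)"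
      using lin_dep_iff_in_span[of S x] Sc indS x colsX \<open>x \<notin> span S\<close> by auto
    then show False using S xS x unfolding maximal_def by blast
  qed
  have "\<exists>a. lincomb a S = col X j" if "j < k" for j
  proof -
    have "col X j \<in> set (cols X)" using X that by (metis carrier_matD(2) cols_length cols_nth nth_mem)
    from inspan[OF this] show ?thesis
      using finite_in_span[OF finS] Sc by metis
  qed
  then obtain a where a: "\<And>j. j < k \<Longrightarrow> lincomb (a j) S = col X j" by metis
  define B where "B = mat r k (\<lambda>(i, j). a j (col A i))"
  have B: "B \<in> carrier_mat r k" by (simp add: B_def)
  have "X = A * B"
  proof (rule mat_col_eqI)
    fix j assume "j < dim_col (A * B)"
    then have j: "j < k" by (simp add: B_def)
    have "col B j = vec r (\<lambda>i. a j (col A i))" using j by (auto simp: B_def)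
    then have "col (A * B) j = A *\<^sub>v vec r (\<lambda>i. a j (col A i))"
      using A B j by (subst col_mult2[OF A B j]) simp
    also have "\<dots> = lincomb (a j) S"
      using mat_mult_eq_lincomb[OF A, of "a j"] vs colsA by simp
    finally show "col X j = col (A * B) j" using a j by simp
  qed (use X A B in auto)
  moreover have "v = 0\<^sub>v r" if "v \<in> carrier_vec r" "A *\<^sub>v v = 0\<^sub>v m" for v
    using lin_depI[OF A that(1) _ that(2)] indS colsA vs by auto
  ultimately show ?thesis using that A B r_def by blast
qed

section \<open>Designs and their moment matrices\<close>

text \<open>The clause for \<open>i \<ge> m\<close> pins the irrelevant coordinates, so that the
  simplex is closed inside a product of intervals and compact by Tychonoff; a determinant can then
  be maximised over it.\<close>

definition prob_weights :: "nat \<Rightarrow> (nat \<Rightarrow> real) set" where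
  "prob_weights m = {p. (\<forall>i<m. 0 \<le> p i) \<and> (\<forall>i\<ge>m. p i = 0) \<and> (\<Sum>i<m. p i) = 1}"

lemma compact_prob_weights: "compact (prob_weights m)"
proof -
  have "compact (Pi\<^sub>E UNIV (\<lambda>i::nat. {0..1::real}))"
    using compactin_PiE[of "\<lambda>_::nat. euclidean" UNIV "\<lambda>_. {0..1::real}"]
    by (simp add: euclidean_product_topology)
  moreover have "closed (prob_weights m)"
    unfolding prob_weights_def
    by (intro closed_Collect_conj closed_Collect_all closed_Collect_imp closed_Collect_le closed_Collect_eq
        open_Collect_const continuous_intros continuous_on_product_coordinates)
  moreover have "prob_weights m \<subseteq> Pi\<^sub>E UNIV (\<lambda>i::nat. {0..1::real})"
  proof
    fix p assume p: "p \<in> prob_weights m"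
    have "p i \<le> 1" if "i < m" for i
      using p that member_le_sum[of i "{..<m}" p] by (auto simp: prob_weights_def)
    then show "p \<in> Pi\<^sub>E UNIV (\<lambda>i::nat. {0..1::real})"
      using p by (auto simp: prob_weights_def) (metis not_le order_refl, metis not_le zero_le_one)
  qed
  ultimately show ?thesis by (metis compact_Int_closed inf.absorb_iff2)
qed

text \<open>The information matrix of a design: the sum over \<open>l\<close> of \<open>p l\<close>
  times the outer square of row \<open>l\<close>.\<close>

definition moment_mat :: "real mat \<Rightarrow> (nat \<Rightarrow> real) \<Rightarrow> real mat" where
  "moment_mat A p = A\<^sup>T * (mat_diag (dim_row A) p * A)"

lemma moment_mat_carrier: "A \<in> carrier_mat m r \<Longrightarrow> moment_mat A p \<in> carrier_mat r r"
  by (auto simp: moment_mat_def)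

lemma moment_mat_index:
  assumes "A \<in> carrier_mat m r" "i < r" "j < r"
  shows "moment_mat A p $$ (i, j) = (\<Sum>l<m. p l * A $$ (l, i) * A $$ (l, j))"
proof -
  have "mat_diag (dim_row A) p * A = mat m r (\<lambda>(i, j). p i * A $$ (i, j))"
    using mat_diag_mult_left[of A "dim_row A" "dim_col A" p] assms by auto
  then show ?thesis
    using assms by (auto simp: moment_mat_def scalar_prod_def atLeast0LessThan mult_ac intro!: sum.cong)
qed

lemma continuous_on_det_moment_mat:
  assumes A: "A \<in> carrier_mat m r"
  shows "continuous_on S (\<lambda>p. det (moment_mat A p))"
proof -
  have "continuous_on S (\<lambda>p. p l)" for l :: nat and S :: "(nat \<Rightarrow> real) set"
    by (rule continuous_on_subset[OF continuous_on_product_coordinates]) simp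
  moreover have "det (moment_mat A p) = (\<Sum>\<pi> | \<pi> permutes {0..<r}. signof \<pi> *
      (\<Prod>i = 0..<r. \<Sum>l<m. p l * A $$ (l, i) * A $$ (l, \<pi> i)))" for p
    by (subst det_def'[OF moment_mat_carrier[OF A]])
      (auto intro!: sum.cong prod.cong simp: moment_mat_index[OF A])
  ultimately show ?thesis
    by (auto intro!: continuous_intros)
qed

text \<open>A null vector \<open>v\<close> would give \<open>A *\<^sub>v v\<close> squared norm 0.
  The uniform design thus witnesses that the maximal determinant is nonzero.\<close>

lemma det_moment_mat_uniform:
  assumes A: "A \<in> carrier_mat m r" and "m \<ge> 1"
    and inj: "\<And>v. v \<in> carrier_vec r \<Longrightarrow> A *\<^sub>v v = 0\<^sub>v m \<Longrightarrow> v = 0\<^sub>v r"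
  shows "det (moment_mat A (\<lambda>i. if i < m then 1 / m else 0)) \<noteq> 0"
proof
  let ?p = "\<lambda>i. if i < m then 1 / real m else 0"
  assume "det (moment_mat A ?p) = 0"
  then obtain v where v: "v \<in> carrier_vec r" "v \<noteq> 0\<^sub>v r" "moment_mat A ?p *\<^sub>v v = 0\<^sub>v r"
    using det_0_iff_vec_prod_zero_field[OF moment_mat_carrier[OF A]] by blast
  have "mat_diag (dim_row A) ?p * A = (1 / m) \<cdot>\<^sub>m A"
    using mat_diag_mult_left[of A "dim_row A" "dim_col A" ?p] A by (auto intro!: eq_matI)
  then have M: "moment_mat A ?p = (1 / m) \<cdot>\<^sub>m (A\<^sup>T * A)"
    using A by (simp add: moment_mat_def mult_smult_distrib[of "A\<^sup>T" r m A r])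
  have Av: "A *\<^sub>v v \<in> carrier_vec m" using A v by auto
  have "(A *\<^sub>v v) \<bullet> (A *\<^sub>v v) = v \<bullet> (A\<^sup>T *\<^sub>v (A *\<^sub>v v))"
    using transpose_vec_mult_scalar[of "A\<^sup>T" r m "A *\<^sub>v v" v] A v Av by simp
  also have "A\<^sup>T *\<^sub>v (A *\<^sub>v v) = 0\<^sub>v r"
  proof -
    have "(1 / m) \<cdot>\<^sub>v (A\<^sup>T *\<^sub>v (A *\<^sub>v v)) = moment_mat A ?p *\<^sub>v v"
      unfolding M assoc_mult_mat_vec[OF transpose_carrier_mat[THEN iffD2, OF A] A v(1), symmetric]
      by (rule eq_vecI) (use A v(1) in \<open>auto simp del: assoc_mult_mat_vec\<close>)
    then have "(1 / m) \<cdot>\<^sub>v (A\<^sup>T *\<^sub>v (A *\<^sub>v v)) = 0\<^sub>v r" using v by simp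
    then have "(1 / m) * (A\<^sup>T *\<^sub>v (A *\<^sub>v v)) $ i = 0" if "i < r" for i
      using that A by (metis carrier_matD(2) dim_mult_mat_vec index_smult_vec(1) index_transpose_mat(2) index_zero_vec(1))
    then show ?thesis using A \<open>m \<ge> 1\<close> by (intro eq_vecI) auto
  qed
  also have "v \<bullet> 0\<^sub>v r = 0" using v by simp
  finally have "A *\<^sub>v v = 0\<^sub>v m"
    using conjugate_square_eq_0_vec[OF Av] by simp
  with inj v show False by blast
qed

text \<open>The expression equals 1 at \<open>t = 0\<close> and has derivative \<open>q - r\<close>
  there, so \<open>q > r\<close> would push it above 1 for small \<open>t\<close>. An explicit
  \<open>t\<close> and Bernoulli's inequality replace differentiation.\<close>

lemma rank_one_growth_bound:
  fixes q :: real
  assumes le: "\<And>t. 0 \<le> t \<Longrightarrow> t < 1 \<Longrightarrow> \<bar>(1 - t) ^ r * (1 + t / (1 - t) * q)\<bar> \<le> 1"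
  shows "q \<le> r"
proof (rule ccontr)
  assume "\<not> q \<le> r"
  then have q: "q > r" "q > 0" by auto
  \<comment> \<open>This \<open>t\<close> satisfies both \<open>t * (r + 1) < 1\<close> and
    \<open>t * (r * q) < q - r\<close>; the latter is what makes
    \<open>(1 - r * t) * (1 + t * q)\<close> exceed 1.\<close>
  define t where "t = (q - r) / ((r + 1) * (q + 1))"
  have t0: "t > 0" using q by (simp add: t_def)
  have "t * (r + 1) = (q - r) / (q + 1)" using q by (simp add: t_def)
  then have t1: "t * (r + 1) < 1" using q by simp
  have "t \<le> t * (r + 1)" using t0 by (simp add: algebra_simps)
  with t1 have tl: "t < 1" by linarith
  have "t * ((r + 1) * (q + 1)) = q - r" using q by (simp add: t_def)
  then have "t * (r * q) < q - r" using t0 q by (simp add: algebra_simps) (smt (verit) mult_pos_pos mult_nonneg_nonneg of_nat_0_le_iff)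
  then have "t * (t * (r * q)) < t * (q - r)" using t0 by (rule mult_strict_left_mono)
  then have "1 < (1 - r * t) * (1 + t * q)" by (simp add: algebra_simps)
  also have "\<dots> \<le> (1 - t) ^ r * (1 + t * q)"
    using Bernoulli_inequality[of "- t" r] tl t0 q by (intro mult_right_mono) auto
  also have "\<dots> \<le> (1 - t) ^ r * (1 + t / (1 - t) * q)"
    using tl t0 q by (intro mult_left_mono add_left_mono mult_right_mono) (auto simp: field_simps)
  also have "\<dots> \<le> 1" using le[of t] tl t0 by simp
  finally show False by simp
qed

text \<open>Kiefer--Wolfowitz: weights maximising the determinant of the moment matrix (a D-optimal
  design) have all leverages \<open>a\<^sub>k\<^sup>T N a\<^sub>k\<close> at most \<open>r\<close>, as moving mass to row \<open>k\<close> changes the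
  determinant by a rank-one update.\<close>
lemma D_optimal_design:
  fixes A :: "real mat"
  assumes A: "A \<in> carrier_mat m r" and "m \<ge> 1"
    and inj: "\<And>v. v \<in> carrier_vec r \<Longrightarrow> A *\<^sub>v v = 0\<^sub>v m \<Longrightarrow> v = 0\<^sub>v r"
  obtains p N where "p \<in> prob_weights m" "N \<in> carrier_mat r r" "N * moment_mat A p = 1\<^sub>m r"
    "\<And>k. k < m \<Longrightarrow> row A k \<bullet> (N *\<^sub>v row A k) \<le> r"
proof -
  let ?u = "\<lambda>i. if i < m then 1 / real m else 0"
  have u: "?u \<in> prob_weights m" using \<open>m \<ge> 1\<close> by (auto simp: prob_weights_def)
  \<comment> \<open>Maximising the absolute value avoids any argument about the sign of the
    determinant, that is, about positive definiteness.\<close>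
  obtain p where p: "p \<in> prob_weights m"
    and opt: "\<And>p'. p' \<in> prob_weights m \<Longrightarrow> \<bar>det (moment_mat A p')\<bar> \<le> \<bar>det (moment_mat A p)\<bar>"
    using continuous_attains_sup[OF compact_prob_weights _
        continuous_on_rabs[OF continuous_on_det_moment_mat[OF A]]] u by blast
  let ?G = "moment_mat A p"
  have G: "?G \<in> carrier_mat r r" by (rule moment_mat_carrier[OF A])
  have detG: "det ?G \<noteq> 0"
    using opt[OF u] det_moment_mat_uniform[OF A \<open>m \<ge> 1\<close> inj] by auto
  obtain N where N: "N \<in> carrier_mat r r" "N * ?G = 1\<^sub>m r" "?G * N = 1\<^sub>m r"
    using det_non_zero_imp_unit[OF G detG, of "()"] by (auto simp: Units_def ring_mat_def)
  have "row A k \<bullet> (N *\<^sub>v row A k) \<le> r" if k: "k < m" for k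
  proof (rule rank_one_growth_bound)
    fix t :: real assume t: "0 \<le> t" "t < 1"
    define a where "a = row A k"
    have a: "a \<in> carrier_vec r" using A by (auto simp: a_def)
    \<comment> \<open>Moving mass \<open>t\<close> to row \<open>k\<close> adds \<open>t\<close>
      times the outer square of \<open>a\<close> to \<open>(1 - t) * ?G\<close>. As
      \<open>?G * N = 1\<close>, factoring out \<open>(1 - t) * ?G\<close> leaves the identity plus
      the outer product of this \<open>w\<close> with \<open>a\<close>.\<close>
    define w where "w = (t / (1 - t)) \<cdot>\<^sub>v (N *\<^sub>v a)"
    have w: "w \<in> carrier_vec r" using N a by (auto simp: w_def)
    define pt where "pt i = (1 - t) * p i + (if i = k then t else 0)" for i
    have pt: "pt \<in> prob_weights m"
      using p t k by (auto simp: prob_weights_def pt_def sum.distrib simp flip: sum_distrib_left)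
    have Gw: "?G *\<^sub>v w = (t / (1 - t)) \<cdot>\<^sub>v a"
    proof -
      have "?G *\<^sub>v (N *\<^sub>v a) = a"
        using N G a by (metis assoc_mult_mat_vec one_mult_mat_vec)
      then show ?thesis using G N a by (simp add: w_def mult_mat_vec[of _ r r])
    qed
    have "moment_mat A pt = (1 - t) \<cdot>\<^sub>m (?G * (1\<^sub>m r + mat r r (\<lambda>(i, j). w $ i * a $ j)))"
    proof (rule eq_matI)
      fix i j assume "i < dim_row ((1 - t) \<cdot>\<^sub>m (?G * (1\<^sub>m r + mat r r (\<lambda>(i, j). w $ i * a $ j))))"
        "j < dim_col ((1 - t) \<cdot>\<^sub>m (?G * (1\<^sub>m r + mat r r (\<lambda>(i, j). w $ i * a $ j))))"
      then have ij: "i < r" "j < r" using G by auto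
      have "?G * (1\<^sub>m r + mat r r (\<lambda>(i, j). w $ i * a $ j)) = ?G + ?G * mat r r (\<lambda>(i, j). w $ i * a $ j)"
        using G by (subst mult_add_distrib_mat[of _ r r _ r]) auto
      moreover have "(?G * mat r r (\<lambda>(i, j). w $ i * a $ j)) $$ (i, j) = (?G *\<^sub>v w) $ i * a $ j"
        using G w ij by (auto simp: scalar_prod_def sum_distrib_right mult.assoc)
      ultimately have "((1 - t) \<cdot>\<^sub>m (?G * (1\<^sub>m r + mat r r (\<lambda>(i, j). w $ i * a $ j)))) $$ (i, j)
          = (1 - t) * ?G $$ (i, j) + t * (a $ i * a $ j)"
        using G ij a t by (simp add: Gw field_simps)
      also have "\<dots> = moment_mat A pt $$ (i, j)"
      proof -
        have "(\<Sum>l<m. pt l * A $$ (l, i) * A $$ (l, j)) =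
          (\<Sum>l<m. (1 - t) * (p l * A $$ (l, i) * A $$ (l, j)) + (if l = k then t * (A $$ (k, i) * A $$ (k, j)) else 0))"
          by (intro sum.cong) (auto simp: pt_def algebra_simps)
        then show ?thesis
          using k A ij by (simp add: moment_mat_index[OF A ij] sum.distrib a_def flip: sum_distrib_left)
      qed
      finally show "moment_mat A pt $$ (i, j) = ((1 - t) \<cdot>\<^sub>m (?G * (1\<^sub>m r + mat r r (\<lambda>(i, j). w $ i * a $ j)))) $$ (i, j)"
        by simp
    qed (use G moment_mat_carrier[OF A, of pt] in auto)
    then have "det (moment_mat A pt) = (1 - t) ^ r * (det ?G * (1 + w \<bullet> a))"
      using G by (simp add: det_mult[where n = r] det_one_plus_rank_one[OF w a])
    moreover have "w \<bullet> a = t / (1 - t) * (row A k \<bullet> (N *\<^sub>v row A k))"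
      using N a by (simp add: w_def comm_scalar_prod[of "N *\<^sub>v a" r a] flip: a_def)
    ultimately have "\<bar>(1 - t) ^ r * (1 + t / (1 - t) * (row A k \<bullet> (N *\<^sub>v row A k)))\<bar> * \<bar>det ?G\<bar> \<le> 1 * \<bar>det ?G\<bar>"
      using opt[OF pt] by (simp add: abs_mult mult_ac)
    then show "\<bar>(1 - t) ^ r * (1 + t / (1 - t) * (row A k \<bullet> (N *\<^sub>v row A k)))\<bar> \<le> 1"
      using detG by (simp add: mult_le_cancel_right)
  qed
  with p N that show ?thesis by blast
qed


section \<open>Max-norm bounds from explicit factorizations\<close>

lemma abs_le_sup_norm:
  assumes "X \<in> carrier_mat m k" "i < m" "j < k"
  shows "\<bar>X $$ (i, j)\<bar> \<le> sup_norm X"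
  unfolding sup_norm_def
proof (rule Max_ge)
  have "{\<bar>X $$ (i, j)\<bar> | i j. i < dim_row X \<and> j < dim_col X} =
      (\<lambda>(i, j). \<bar>X $$ (i, j)\<bar>) ` ({..<dim_row X} \<times> {..<dim_col X})" by auto
  then show "finite ({\<bar>X $$ (i, j)\<bar> | i j. i < dim_row X \<and> j < dim_col X} \<union> {0})" by simp
qed (use assms in auto)

lemma two_inf_norm_nonneg: "0 \<le> two_inf_norm U"
  unfolding two_inf_norm_def by (rule Max_ge) auto

lemma row_sum_sq_le_two_inf_norm:
  assumes "i < dim_row U"
  shows "(\<Sum>j<dim_col U. (U $$ (i, j))\<^sup>2) \<le> (two_inf_norm U)\<^sup>2"
proof -
  have "sqrt (\<Sum>j<dim_col U. (U $$ (i, j))\<^sup>2) \<le> two_inf_norm U"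
    unfolding two_inf_norm_def using assms by (intro Max_ge) auto
  then show ?thesis by (rule sqrt_le_D)
qed

lemma two_inf_norm_le:
  assumes "c \<ge> 0" "\<And>i. i < dim_row U \<Longrightarrow> (\<Sum>j<dim_col U. (U $$ (i, j))\<^sup>2) \<le> c\<^sup>2"
  shows "two_inf_norm U \<le> c"
  unfolding two_inf_norm_def using assms by (intro Max.boundedI) (auto intro!: real_le_lsqrt sum_nonneg)

lemma max_norm_le:
  assumes "U \<in> carrier_mat (dim_row X) l" "V \<in> carrier_mat (dim_col X) l" "X = U * V\<^sup>T"
  shows "max_norm X \<le> two_inf_norm U * two_inf_norm V"
  unfolding max_norm_def
proof (rule cInf_lower)
  show "bdd_below {two_inf_norm U * two_inf_norm V | U V k.
      U \<in> carrier_mat (dim_row X) k \<and> V \<in> carrier_mat (dim_col X) k \<and> X = U * transpose_mat V}"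
    by (rule bdd_belowI[of _ 0]) (auto simp: two_inf_norm_nonneg)
qed (use assms in blast)

text \<open>With D-optimal weights \<open>p\<close> and \<open>H = A N A\<^sup>T\<close>, the factors are
  \<open>U = H (diag p)\<^bsup>1/2\<^esup>\<close>, whose squared row norms are the leverages, and
  \<open>V = X\<^sup>T (diag p)\<^bsup>1/2\<^esup>\<close>.\<close>
theorem max_norm_le_sqrt_rank:
  fixes X :: "real mat"
  assumes X: "X \<in> carrier_mat m k" and "m \<ge> 1" and "\<gamma> \<ge> 0" and sup: "sup_norm X \<le> \<gamma>"
  shows "max_norm X \<le> \<gamma> * sqrt (matrix_rank X)"
proof -
  define r where "r = matrix_rank X"
  obtain A B where A: "A \<in> carrier_mat m r" and B: "B \<in> carrier_mat r k" and XAB: "X = A * B"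
    and inj: "\<And>v. v \<in> carrier_vec r \<Longrightarrow> A *\<^sub>v v = 0\<^sub>v m \<Longrightarrow> v = 0\<^sub>v r"
    using rank_factorization[OF X] unfolding r_def by metis
  obtain p N where p: "p \<in> prob_weights m" and N: "N \<in> carrier_mat r r"
    and NG: "N * moment_mat A p = 1\<^sub>m r"
    and lev: "\<And>k. k < m \<Longrightarrow> row A k \<bullet> (N *\<^sub>v row A k) \<le> r"
    using D_optimal_design[OF A \<open>m \<ge> 1\<close> inj] by metis
  have p0: "p i \<ge> 0" if "i < m" for i using p that by (simp add: prob_weights_def)
  have p1: "(\<Sum>i<m. p i) = 1" using p by (simp add: prob_weights_def)
  define D where "D = mat_diag m p"
  have D: "D \<in> carrier_mat m m" by (simp add: D_def)
  have At: "A\<^sup>T \<in> carrier_mat r m" using A by simp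
  define H where "H = A * (N * A\<^sup>T)"
  have NAt: "N * A\<^sup>T \<in> carrier_mat r m" using N At by simp
  have H: "H \<in> carrier_mat m m" using A NAt by (simp add: H_def)
  have DA: "D * A \<in> carrier_mat m r" using A D by simp
  have NG': "N * (A\<^sup>T * (D * A)) = 1\<^sub>m r"
    using NG A by (simp add: moment_mat_def D_def)
  \<comment> \<open>\<open>H * D\<close> is the weighted least squares projection onto the column
    space of \<open>A\<close>, so it fixes \<open>A\<close> and hence
    \<open>X = A * B\<close>.\<close>
  have HDA: "H * (D * A) = A"
  proof -
    have "H * (D * A) = A * ((N * A\<^sup>T) * (D * A))"
      unfolding H_def by (rule assoc_mult_mat[OF A NAt DA])
    also have "(N * A\<^sup>T) * (D * A) = N * (A\<^sup>T * (D * A))"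
      by (rule assoc_mult_mat[OF N At DA])
    finally show ?thesis using NG' A by simp
  qed
  have HDX: "H * (D * X) = X"
  proof -
    have "H * (D * X) = H * ((D * A) * B)"
      unfolding XAB assoc_mult_mat[OF D A B] ..
    also have "\<dots> = (H * (D * A)) * B"
      by (rule assoc_mult_mat[OF H DA B, symmetric])
    finally show ?thesis using HDA XAB by simp
  qed
  have Ht: "H\<^sup>T = A * (N\<^sup>T * A\<^sup>T)"
    unfolding H_def transpose_mult[OF A NAt] transpose_mult[OF N At]
    using A N by (simp add: assoc_mult_mat[of A m r "N\<^sup>T" r "A\<^sup>T" m])
  \<comment> \<open>Symmetry of \<open>N\<close> is not at hand, so the identity yields
    \<open>H\<^sup>T\<close> rather than \<open>H\<close>; on the diagonal, where the squared row
    norms of \<open>U\<close> are read off, the two agree.\<close>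
  have HDH: "H * (D * H\<^sup>T) = H\<^sup>T"
  proof -
    have NtAt: "N\<^sup>T * A\<^sup>T \<in> carrier_mat r m" using N At by simp
    have "H * (D * H\<^sup>T) = H * ((D * A) * (N\<^sup>T * A\<^sup>T))"
      unfolding Ht assoc_mult_mat[OF D A NtAt] ..
    also have "\<dots> = (H * (D * A)) * (N\<^sup>T * A\<^sup>T)"
      by (rule assoc_mult_mat[OF H DA NtAt, symmetric])
    finally show ?thesis using HDA Ht by simp
  qed
  have entry: "(H * (D * Z)) $$ (i, j) = (\<Sum>l<m. p l * H $$ (i, l) * Z $$ (l, j))"
    if "Z \<in> carrier_mat m q" "i < m" "j < q" for Z i j q
  proof -
    have "D * Z = mat m q (\<lambda>(i, j). p i * Z $$ (i, j))"
      unfolding D_def using that by (intro mat_diag_mult_left) auto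
    then show ?thesis
      using H that by (auto simp: scalar_prod_def atLeast0LessThan mult_ac intro!: sum.cong)
  qed
  define U where "U = mat m m (\<lambda>(i, l). sqrt (p l) * H $$ (i, l))"
  define V where "V = mat k m (\<lambda>(j, l). sqrt (p l) * X $$ (l, j))"
  have "X = U * V\<^sup>T"
  proof (rule eq_matI)
    fix i j assume "i < dim_row (U * V\<^sup>T)" "j < dim_col (U * V\<^sup>T)"
    then have ij: "i < m" "j < k" by (auto simp: U_def V_def)
    have "(U * V\<^sup>T) $$ (i, j) = (\<Sum>l<m. (sqrt (p l) * sqrt (p l)) * H $$ (i, l) * X $$ (l, j))"
      using ij by (auto simp: U_def V_def scalar_prod_def atLeast0LessThan mult_ac intro!: sum.cong)
    also have "\<dots> = (\<Sum>l<m. p l * H $$ (i, l) * X $$ (l, j))"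
      using p0 by (intro sum.cong) auto
    also have "\<dots> = X $$ (i, j)"
      using entry[OF X ij] HDX by simp
    finally show "X $$ (i, j) = (U * V\<^sup>T) $$ (i, j)" by simp
  qed (use X in \<open>auto simp: U_def V_def\<close>)
  then have "max_norm X \<le> two_inf_norm U * two_inf_norm V"
    using X by (intro max_norm_le[of _ _ m]) (auto simp: U_def V_def)
  also have "\<dots> \<le> sqrt r * \<gamma>"
  proof (intro mult_mono two_inf_norm_le two_inf_norm_nonneg)
    fix i assume "i < dim_row U"
    then have i: "i < m" by (simp add: U_def)
    have "(\<Sum>l<dim_col U. (U $$ (i, l))\<^sup>2) = (\<Sum>l<m. p l * H $$ (i, l) * H\<^sup>T $$ (l, i))"
      using i p0 H by (auto simp: U_def power_mult_distrib power2_eq_square intro!: sum.cong)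
    also have "\<dots> = H $$ (i, i)"
      using entry[of "H\<^sup>T" m i i] HDH H i by simp
    also have "\<dots> = row A i \<bullet> (N *\<^sub>v row A i)"
      using A N At i by (simp add: H_def col_mult2[of N r r "A\<^sup>T" m i] mult_mat_vec_def)
    finally show "(\<Sum>l<dim_col U. (U $$ (i, l))\<^sup>2) \<le> (sqrt r)\<^sup>2"
      using lev[OF i] by simp
  next
    fix j assume "j < dim_row V"
    then have j: "j < k" by (simp add: V_def)
    have "(\<Sum>l<dim_col V. (V $$ (j, l))\<^sup>2) = (\<Sum>l<m. p l * (X $$ (l, j))\<^sup>2)"
      using j p0 by (auto simp: V_def power_mult_distrib intro!: sum.cong)
    also have "\<dots> \<le> (\<Sum>l<m. p l * \<gamma>\<^sup>2)"
    proof (intro sum_mono mult_left_mono)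
      fix l assume "l \<in> {..<m}"
      then have "\<bar>X $$ (l, j)\<bar> \<le> \<bar>\<gamma>\<bar>"
        using abs_le_sup_norm[OF X, of l j] j sup by simp
      then show "(X $$ (l, j))\<^sup>2 \<le> \<gamma>\<^sup>2" by (rule abs_le_square_iff[THEN iffD1])
    qed (use p0 in auto)
    also have "\<dots> = \<gamma>\<^sup>2" by (simp add: p1 flip: sum_distrib_right)
    finally show "(\<Sum>l<dim_col V. (V $$ (j, l))\<^sup>2) \<le> \<gamma>\<^sup>2" .
  qed (use \<open>\<gamma> \<ge> 0\<close> in auto)
  finally show ?thesis by (simp add: r_def mult.commute)
qed

subsection \<open>Grothendieck's inequality\<close>

text \<open>A Rademacher sum, with \<open>A\<close> standing for the sign pattern that is +1 on
  \<open>A\<close> and -1 off it. Averages over \<open>Pow J\<close> are then expectations.\<close>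

definition rsum :: "('i \<Rightarrow> real) \<Rightarrow> 'i set \<Rightarrow> 'i set \<Rightarrow> real" where
  "rsum u J A = (\<Sum>j\<in>J. (if j \<in> A then 1 else -1) * u j)"

text \<open>Conditioning on the sign of \<open>x\<close>; the general \<open>F\<close> serves both
  the second and the fourth moment.\<close>

lemma sum_Pow_rsum_insert:
  fixes F :: "real \<Rightarrow> real \<Rightarrow> real"
  assumes "finite J" "x \<notin> J"
  shows "(\<Sum>A\<in>Pow (insert x J). F (rsum u (insert x J) A) (rsum v (insert x J) A)) =
    (\<Sum>A\<in>Pow J. F (rsum u J A - u x) (rsum v J A - v x) + F (rsum u J A + u x) (rsum v J A + v x))"
proof -
  have inj: "inj_on (insert x) (Pow J)"
    using assms(2) by (auto simp: inj_on_def)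
  have out: "rsum w (insert x J) A = rsum w J A - w x" if "A \<in> Pow J" for A and w :: "'a \<Rightarrow> real"
    using that assms by (auto simp: rsum_def)
  have into: "rsum w (insert x J) (insert x A) = rsum w J A + w x" if "A \<in> Pow J" for A and w :: "'a \<Rightarrow> real"
  proof -
    have "(\<Sum>j\<in>J. (if j \<in> insert x A then 1 else -1) * w j) = rsum w J A"
      unfolding rsum_def by (rule sum.cong) (use assms(2) in auto)
    then show ?thesis using assms by (simp add: rsum_def)
  qed
  have "(\<Sum>A\<in>Pow (insert x J). F (rsum u (insert x J) A) (rsum v (insert x J) A)) =
     (\<Sum>A\<in>Pow J. F (rsum u (insert x J) A) (rsum v (insert x J) A)) +
     (\<Sum>A\<in>insert x ` Pow J. F (rsum u (insert x J) A) (rsum v (insert x J) A))"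
    unfolding Pow_insert by (rule sum.union_disjoint) (use assms in auto)
  also have "\<dots> = (\<Sum>A\<in>Pow J. F (rsum u J A - u x) (rsum v J A - v x)) +
     (\<Sum>A\<in>Pow J. F (rsum u J A + u x) (rsum v J A + v x))"
    by (simp add: sum.reindex[OF inj] out into)
  finally show ?thesis by (simp add: sum.distrib)
qed

text \<open>Distinct signs are orthogonal, so up to the factor \<open>2 ^ card J\<close> passing
  from vectors to their Rademacher sums preserves inner products.\<close>

lemma sum_Pow_rsum_mult:
  assumes "finite J"
  shows "(\<Sum>A\<in>Pow J. rsum u J A * rsum v J A) = 2 ^ card J * (\<Sum>j\<in>J. u j * v j)"
  using assms
proof (induction J)
  case empty
  then show ?case by (simp add: rsum_def)
next
  case (insert x J)
  have "(\<Sum>A\<in>Pow (insert x J). rsum u (insert x J) A * rsum v (insert x J) A) =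
    (\<Sum>A\<in>Pow J. 2 * (rsum u J A * rsum v J A) + 2 * (u x * v x))"
    using insert by (simp add: sum_Pow_rsum_insert[where F = "\<lambda>a b. a * b"] algebra_simps)
  also have "\<dots> = 2 * (\<Sum>A\<in>Pow J. rsum u J A * rsum v J A) + 2 ^ card J * (2 * (u x * v x))"
    using insert.hyps by (simp add: sum.distrib card_Pow flip: sum_distrib_left)
  also have "\<dots> = 2 ^ card (insert x J) * (\<Sum>j\<in>insert x J. u j * v j)"
    unfolding insert.IH using insert.hyps by (simp add: distrib_left)
  finally show ?case .
qed

text \<open>Khintchine's inequality for the fourth moment. Splitting off one sign cancels the odd
  powers; with the Gaussian constant 3 the mixed terms match exactly and only the pure fourth power
  has slack.\<close>

lemma sum_Pow_rsum_pow4: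
  assumes "finite J"
  shows "(\<Sum>A\<in>Pow J. rsum u J A ^ 4) \<le> 3 * 2 ^ card J * (\<Sum>j\<in>J. (u j)\<^sup>2)\<^sup>2"
  using assms
proof (induction J)
  case empty
  then show ?case by (simp add: rsum_def)
next
  case (insert x J)
  let ?s = "\<Sum>j\<in>J. (u j)\<^sup>2"
  have sq: "(\<Sum>A\<in>Pow J. (rsum u J A)\<^sup>2) = 2 ^ card J * ?s"
    using sum_Pow_rsum_mult[OF insert(1), of u u] by (simp add: power2_eq_square)
  have "(\<Sum>A\<in>Pow (insert x J). rsum u (insert x J) A ^ 4) =
    (\<Sum>A\<in>Pow J. (rsum u J A - u x) ^ 4 + (rsum u J A + u x) ^ 4)"
    using insert sum_Pow_rsum_insert[where F = "\<lambda>a b. a ^ 4" and u = u and v = u] by simp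
  also have "\<dots> = (\<Sum>A\<in>Pow J. 2 * rsum u J A ^ 4 + 12 * (u x)\<^sup>2 * (rsum u J A)\<^sup>2 + 2 * u x ^ 4)"
    by (rule sum.cong) (auto simp: power4_eq_xxxx power2_eq_square algebra_simps)
  also have "\<dots> = 2 * (\<Sum>A\<in>Pow J. rsum u J A ^ 4) + 12 * (u x)\<^sup>2 * (2 ^ card J * ?s) + 2 ^ card J * (2 * u x ^ 4)"
    unfolding sq[symmetric] using insert.hyps by (simp add: sum.distrib card_Pow flip: sum_distrib_left)
  also have "\<dots> \<le> 2 * (3 * 2 ^ card J * ?s\<^sup>2) + 12 * (u x)\<^sup>2 * (2 ^ card J * ?s) + 2 ^ card J * (2 * u x ^ 4)"
    using insert by simp
  also have "\<dots> \<le> 2 ^ card J * (6 * (?s + (u x)\<^sup>2)\<^sup>2)"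
  proof -
    have "2 * u x ^ 4 \<le> 6 * ((u x)\<^sup>2)\<^sup>2" by simp
    then have "6 * ?s\<^sup>2 + 12 * (u x)\<^sup>2 * ?s + 2 * u x ^ 4 \<le> 6 * (?s + (u x)\<^sup>2)\<^sup>2"
      by (simp add: power2_sum algebra_simps)
    then have "2 ^ card J * (6 * ?s\<^sup>2 + 12 * (u x)\<^sup>2 * ?s + 2 * u x ^ 4) \<le> 2 ^ card J * (6 * (?s + (u x)\<^sup>2)\<^sup>2)"
      by (intro mult_left_mono) auto
    then show ?thesis by (simp add: algebra_simps)
  qed
  finally show ?case
    using insert by (simp add: algebra_simps)
qed

section \<open>Clipping, reduction to signs, and Gram forms\<close>

definition clip :: "real \<Rightarrow> real \<Rightarrow> real" where
  "clip M x = max (-M) (min M x)"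

lemma abs_clip_le: "M \<ge> 0 \<Longrightarrow> \<bar>clip M x\<bar> \<le> M"
  by (auto simp: clip_def)

lemma clip_sq_le: "M \<ge> 0 \<Longrightarrow> (clip M x)\<^sup>2 \<le> x\<^sup>2"
  by (rule abs_le_square_iff[THEN iffD1]) (auto simp: clip_def)

lemma clip_remainder_sq_le:
  assumes "M > 0"
  shows "(x - clip M x)\<^sup>2 \<le> x ^ 4 / (16 * M\<^sup>2)"
proof -
  \<comment> \<open>AM-GM: \<open>\<bar>x\<bar> - M \<le> x\<^sup>2 / (4 * M)\<close>\<close>
  have "0 \<le> (\<bar>x\<bar> - 2 * M)\<^sup>2" by simp
  then have "4 * M * (\<bar>x\<bar> - M) \<le> x\<^sup>2"
    by (simp add: power2_diff algebra_simps power2_eq_square)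
  then have "\<bar>x\<bar> - M \<le> x\<^sup>2 / (4 * M)"
    using assms by (simp add: field_simps)
  moreover have "\<bar>x - clip M x\<bar> = max 0 (\<bar>x\<bar> - M)"
    using assms by (auto simp: clip_def)
  moreover have "0 \<le> x\<^sup>2 / (4 * M)" using assms by simp
  ultimately have "\<bar>x - clip M x\<bar> \<le> \<bar>x\<^sup>2 / (4 * M)\<bar>" by linarith
  then have "(x - clip M x)\<^sup>2 \<le> (x\<^sup>2 / (4 * M))\<^sup>2"
    by (rule abs_le_square_iff[THEN iffD1])
  then show ?thesis by (simp add: power_divide power_mult_distrib flip: power_mult)
qed

text \<open>The form is linear in each variable separately, so its maximum over a box is attained at
  a corner: each \<open>x a\<close> is replaced by \<open>M\<close> times the sign of its
  coefficient, then each \<open>y b\<close> likewise.\<close>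

lemma bilinear_le_signs:
  fixes E :: "'a \<Rightarrow> 'b \<Rightarrow> real"
  assumes signs: "\<And>s t. range s \<subseteq> {-1, 1} \<Longrightarrow> range t \<subseteq> {-1, 1} \<Longrightarrow>
      (\<Sum>a\<in>I. \<Sum>b\<in>J. E a b * (s a * t b)) \<le> B"
    and x: "\<And>a. \<bar>x a\<bar> \<le> M" and y: "\<And>b. \<bar>y b\<bar> \<le> N"
  shows "(\<Sum>a\<in>I. \<Sum>b\<in>J. E a b * (x a * y b)) \<le> M * N * B"
proof -
  have M: "M \<ge> 0" and N: "N \<ge> 0" using x y abs_ge_zero order_trans by blast+
  define s :: "'a \<Rightarrow> real" where "s a = (if (\<Sum>b\<in>J. E a b * y b) \<ge> 0 then 1 else -1)" for a
  define t :: "'b \<Rightarrow> real" where "t b = (if (\<Sum>a\<in>I. E a b * s a) \<ge> 0 then 1 else -1)" for b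
  have "(\<Sum>a\<in>I. \<Sum>b\<in>J. E a b * (x a * y b)) = (\<Sum>a\<in>I. x a * (\<Sum>b\<in>J. E a b * y b))"
    by (simp add: sum_distrib_left algebra_simps)
  also have "\<dots> \<le> (\<Sum>a\<in>I. M * (s a * (\<Sum>b\<in>J. E a b * y b)))"
  proof (rule sum_mono)
    fix a
    have "x a * (\<Sum>b\<in>J. E a b * y b) \<le> \<bar>x a\<bar> * \<bar>\<Sum>b\<in>J. E a b * y b\<bar>"
      by (metis abs_ge_self abs_mult)
    also have "\<dots> \<le> M * \<bar>\<Sum>b\<in>J. E a b * y b\<bar>"
      using x by (intro mult_right_mono) auto
    also have "\<bar>\<Sum>b\<in>J. E a b * y b\<bar> = s a * (\<Sum>b\<in>J. E a b * y b)"
      by (simp add: s_def)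
    finally show "x a * (\<Sum>b\<in>J. E a b * y b) \<le> M * (s a * (\<Sum>b\<in>J. E a b * y b))" .
  qed
  also have "\<dots> = M * (\<Sum>b\<in>J. y b * (\<Sum>a\<in>I. E a b * s a))"
    by (simp add: sum_distrib_left algebra_simps) (rule sum.swap)
  also have "\<dots> \<le> M * (\<Sum>b\<in>J. N * (t b * (\<Sum>a\<in>I. E a b * s a)))"
  proof (intro mult_left_mono sum_mono M)
    fix b
    have "y b * (\<Sum>a\<in>I. E a b * s a) \<le> \<bar>y b\<bar> * \<bar>\<Sum>a\<in>I. E a b * s a\<bar>"
      by (metis abs_ge_self abs_mult)
    also have "\<dots> \<le> N * \<bar>\<Sum>a\<in>I. E a b * s a\<bar>"
      using y by (intro mult_right_mono) auto
    also have "\<bar>\<Sum>a\<in>I. E a b * s a\<bar> = t b * (\<Sum>a\<in>I. E a b * s a)"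
      by (simp add: t_def)
    finally show "y b * (\<Sum>a\<in>I. E a b * s a) \<le> N * (t b * (\<Sum>a\<in>I. E a b * s a))" .
  qed
  also have "\<dots> = M * N * (\<Sum>b\<in>J. \<Sum>a\<in>I. E a b * (s a * t b))"
    by (simp add: sum_distrib_left algebra_simps)
  also have "\<dots> = M * N * (\<Sum>a\<in>I. \<Sum>b\<in>J. E a b * (s a * t b))"
    by (subst sum.swap) simp
  also have "\<dots> \<le> M * N * B"
    using M N by (intro mult_left_mono signs) (auto simp: s_def t_def)
  finally show ?thesis .
qed

text \<open>Vectors of every finite dimension are allowed because the argument passes from
  \<open>k\<close> coordinates to \<open>2 ^ k\<close> and must stay inside the same
  supremum.\<close>

definition gram_forms :: "('a \<Rightarrow> 'b \<Rightarrow> real) \<Rightarrow> 'a set \<Rightarrow> 'b set \<Rightarrow> real set" where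
  "gram_forms E I J = {(\<Sum>a\<in>I. \<Sum>b\<in>J. E a b * (\<Sum>j<k. u a j * v b j)) | (k::nat) u v.
     (\<forall>a. (\<Sum>j<k. (u a j)\<^sup>2) \<le> 1) \<and> (\<forall>b. (\<Sum>j<k. (v b j)\<^sup>2) \<le> 1)}"

lemma gram_formsI:
  assumes "finite K" "\<And>a. (\<Sum>j\<in>K. (u a j)\<^sup>2) \<le> 1" "\<And>b. (\<Sum>j\<in>K. (v b j)\<^sup>2) \<le> 1"
  shows "(\<Sum>a\<in>I. \<Sum>b\<in>J. E a b * (\<Sum>j\<in>(K::'c set). u a j * v b j)) \<in> gram_forms E I J"
proof -
  obtain h where h: "bij_betw h {..<card K} K"
    using ex_bij_betw_nat_finite[OF assms(1)] by (auto simp: atLeast0LessThan)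
  have *: "(\<Sum>j\<in>K. f j) = (\<Sum>j<card K. f (h j))" for f :: "'c \<Rightarrow> real"
    using sum.reindex_bij_betw[OF h, of f] by simp
  show ?thesis
    unfolding gram_forms_def mem_Collect_eq
    by (intro exI[of _ "card K"] exI[of _ "\<lambda>a j. u a (h j)"] exI[of _ "\<lambda>b j. v b (h j)"])
      (use assms(2,3) in \<open>simp add: *\<close>)
qed

text \<open>Finiteness of the supremum \<open>S\<close> is what allows a bound
  \<open>S \<le> 4 * B + S / 2\<close> to be solved for \<open>S\<close>.\<close>

lemma bdd_above_gram_forms: "bdd_above (gram_forms E I J)"
proof (rule bdd_aboveI)
  fix x assume "x \<in> gram_forms E I J"
  then obtain k u v where x: "x = (\<Sum>a\<in>I. \<Sum>b\<in>J. E a b * (\<Sum>j<(k::nat). u a j * v b j))"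
    and u: "\<And>a. (\<Sum>j<k. (u a j)\<^sup>2) \<le> 1" and v: "\<And>b. (\<Sum>j<k. (v b j)\<^sup>2) \<le> 1"
    by (auto simp: gram_forms_def)
  have "\<bar>\<Sum>j<k. u a j * v b j\<bar> \<le> 1" for a b
  proof -
    have "(\<Sum>j<k. u a j * v b j)\<^sup>2 \<le> (\<Sum>j<k. (u a j)\<^sup>2) * (\<Sum>j<k. (v b j)\<^sup>2)"
      by (rule Cauchy_Schwarz_ineq_sum)
    also have "\<dots> \<le> 1 * 1" using u v by (intro mult_mono) (auto intro: sum_nonneg)
    finally show ?thesis by (simp add: abs_square_le_1)
  qed
  then have "E a b * (\<Sum>j<k. u a j * v b j) \<le> \<bar>E a b\<bar> * 1" for a b
    by (intro order_trans[OF abs_ge_self[of "E a b * _"]]) (simp add: abs_mult mult_left_le)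
  then show "x \<le> (\<Sum>a\<in>I. \<Sum>b\<in>J. \<bar>E a b\<bar>)"
    unfolding x by (intro sum_mono) simp
qed

text \<open>Replace each vector \<open>u\<close> by the Rademacher sum \<open>rsum u\<close>, viewed as a vector indexed by sign
  patterns, and clip it at 2. The clipped parts are bounded and hence controlled by signs, while
  the two remainder terms are again Gram forms, of vectors of norm at most 1/4.\<close>
lemma gram_forms_le:
  fixes E :: "'a \<Rightarrow> 'b \<Rightarrow> real"
  assumes signs: "\<And>s t. range s \<subseteq> {-1, 1} \<Longrightarrow> range t \<subseteq> {-1, 1} \<Longrightarrow>
      (\<Sum>a\<in>I. \<Sum>b\<in>J. E a b * (s a * t b)) \<le> B"
    and "x \<in> gram_forms E I J"
  shows "x \<le> 8 * B"
proof -
  define S where "S = Sup (gram_forms E I J)"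
  have upper: "y \<le> S" if "y \<in> gram_forms E I J" for y
    unfolding S_def using that bdd_above_gram_forms by (rule cSup_upper)
  have step: "y \<le> 4 * B + S / 2" if "y \<in> gram_forms E I J" for y
  proof -
    obtain k u v where y: "y = (\<Sum>a\<in>I. \<Sum>b\<in>J. E a b * (\<Sum>j<(k::nat). u a j * v b j))"
      and u: "\<And>a. (\<Sum>j<k. (u a j)\<^sup>2) \<le> 1" and v: "\<And>b. (\<Sum>j<k. (v b j)\<^sup>2) \<le> 1"
      using \<open>y \<in> _\<close> by (auto simp: gram_forms_def)
    define P where "P = Pow {..<k}"
    define q :: real where "q = sqrt (2 ^ k)"
    have q: "q > 0" "q\<^sup>2 = 2 ^ k" by (auto simp: q_def)
    define g where "g w A = rsum w {..<k} A" for w A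
    define c where "c w A = clip 2 (g w A)" for w A
    have fin: "finite P" by (simp add: P_def)
    have cardP: "real (card P) = q\<^sup>2" by (simp add: P_def card_Pow q)
    have gg: "(\<Sum>A\<in>P. g w A * g z A) = q\<^sup>2 * (\<Sum>j<k. w j * z j)" for w z
      using sum_Pow_rsum_mult[of "{..<k}" w z] by (simp add: P_def g_def q)
    have g2: "(\<Sum>A\<in>P. (g w A / q)\<^sup>2) \<le> 1" if "(\<Sum>j<k. (w j)\<^sup>2) \<le> 1" for w
      using gg[of w w] that q(1)
      by (simp add: power_divide power2_eq_square flip: sum_divide_distrib)
    have c2: "(\<Sum>A\<in>P. (c w A / q)\<^sup>2) \<le> 1" if "(\<Sum>j<k. (w j)\<^sup>2) \<le> 1" for w
    proof -
      have "(\<Sum>A\<in>P. (c w A / q)\<^sup>2) \<le> (\<Sum>A\<in>P. (g w A / q)\<^sup>2)"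
        unfolding power_divide c_def by (intro sum_mono divide_right_mono clip_sq_le) auto
      with g2[OF that] show ?thesis by linarith
    qed
    \<comment> \<open>The normalized fourth moment is at most 3 and clipping is at 2, so the
      remainder over \<open>q\<close> has squared norm at most \<open>3 / 64\<close>; the factor 4
      brings this to \<open>3 / 4\<close>.\<close>
    have r2: "(\<Sum>A\<in>P. (4 * (g w A - c w A) / q)\<^sup>2) \<le> 1" if w: "(\<Sum>j<k. (w j)\<^sup>2) \<le> 1" for w
    proof -
      have "(\<Sum>A\<in>P. (4 * (g w A - c w A) / q)\<^sup>2) = (\<Sum>A\<in>P. 16 / q\<^sup>2 * (g w A - c w A)\<^sup>2)"
        by (intro sum.cong refl) (simp only: power_divide power_mult_distrib, simp)
      also have "\<dots> \<le> (\<Sum>A\<in>P. 16 / q\<^sup>2 * (g w A ^ 4 / (16 * 2\<^sup>2)))"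
        unfolding c_def by (intro sum_mono mult_left_mono clip_remainder_sq_le) auto
      also have "\<dots> = (\<Sum>A\<in>P. g w A ^ 4) / (4 * q\<^sup>2)"
        by (simp add: sum_divide_distrib)
      also have "\<dots> \<le> (3 * 2 ^ k * (\<Sum>j<k. (w j)\<^sup>2)\<^sup>2) / (4 * q\<^sup>2)"
        using sum_Pow_rsum_pow4[of "{..<k}" w] q(1)
        by (intro divide_right_mono) (auto simp: P_def g_def)
      also have "\<dots> \<le> 3 * (\<Sum>j<k. (w j)\<^sup>2)\<^sup>2 / 4" using q by simp
      also have "\<dots> \<le> 1"
      proof -
        have "(\<Sum>j<k. (w j)\<^sup>2)\<^sup>2 \<le> 1" using w by (intro power_le_one sum_nonneg) auto
        then show ?thesis by simp
      qed
      finally show ?thesis .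
    qed
    \<comment> \<open>Uses \<open>g g' = c c' + (g - c) g' + c (g' - c')\<close>, arranged
      asymmetrically so that only two remainder terms occur, each with one small factor.\<close>
    have split: "(\<Sum>j<k. u a j * v b j) = (\<Sum>A\<in>P. c (u a) A * c (v b) A) / q\<^sup>2
       + (\<Sum>A\<in>P. (4 * (g (u a) A - c (u a) A) / q) * (g (v b) A / q)) / 4
       + (\<Sum>A\<in>P. (c (u a) A / q) * (4 * (g (v b) A - c (v b) A) / q)) / 4" for a b
    proof -
      have "(\<Sum>j<k. u a j * v b j) = (\<Sum>A\<in>P. g (u a) A * g (v b) A) / q\<^sup>2"
        using gg[of "u a" "v b"] q(1) by simp
      also have "\<dots> = (\<Sum>A\<in>P. c (u a) A * c (v b) A / q\<^sup>2
       + (4 * (g (u a) A - c (u a) A) / q) * (g (v b) A / q) / 4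
       + (c (u a) A / q) * (4 * (g (v b) A - c (v b) A) / q) / 4)"
        unfolding sum_divide_distrib
        by (rule sum.cong) (use q(1) in \<open>auto simp: field_simps power2_eq_square\<close>)
      finally show ?thesis by (simp add: sum.distrib sum_divide_distrib)
    qed
    have main: "(\<Sum>a\<in>I. \<Sum>b\<in>J. E a b * ((\<Sum>A\<in>P. c (u a) A * c (v b) A) / q\<^sup>2)) \<le> 4 * B"
    proof -
      have "(\<Sum>a\<in>I. \<Sum>b\<in>J. E a b * ((\<Sum>A\<in>P. c (u a) A * c (v b) A) / q\<^sup>2)) =
        (\<Sum>a\<in>I. \<Sum>b\<in>J. \<Sum>A\<in>P. E a b * (c (u a) A * c (v b) A)) / q\<^sup>2"
        by (simp add: sum_distrib_left sum_divide_distrib)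
      also have "(\<Sum>a\<in>I. \<Sum>b\<in>J. \<Sum>A\<in>P. E a b * (c (u a) A * c (v b) A)) =
        (\<Sum>a\<in>I. \<Sum>A\<in>P. \<Sum>b\<in>J. E a b * (c (u a) A * c (v b) A))"
        by (intro sum.cong refl sum.swap)
      also have "\<dots> = (\<Sum>A\<in>P. \<Sum>a\<in>I. \<Sum>b\<in>J. E a b * (c (u a) A * c (v b) A))"
        by (rule sum.swap)
      \<comment> \<open>For a fixed sign pattern the clipped values are plain numbers bounded by
        2.\<close>
      also have "\<dots> \<le> (\<Sum>A\<in>P. 2 * 2 * B)"
        by (intro sum_mono bilinear_le_signs signs) (auto simp: c_def abs_clip_le)
      also have "\<dots> = q\<^sup>2 * (4 * B)" using cardP by simp
      finally show ?thesis using q(1) by (simp add: divide_right_mono field_simps)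
    qed
    have rem1: "(\<Sum>a\<in>I. \<Sum>b\<in>J. E a b * (\<Sum>A\<in>P. (4 * (g (u a) A - c (u a) A) / q) * (g (v b) A / q))) \<le> S"
      by (intro upper gram_formsI fin r2 g2 u v)
    have rem2: "(\<Sum>a\<in>I. \<Sum>b\<in>J. E a b * (\<Sum>A\<in>P. (c (u a) A / q) * (4 * (g (v b) A - c (v b) A) / q))) \<le> S"
      by (intro upper gram_formsI fin r2 c2 u v)
    have lin: "(\<Sum>a\<in>I. \<Sum>b\<in>J. E a b * (f1 a b + f2 a b / 4 + f3 a b / 4)) =
      (\<Sum>a\<in>I. \<Sum>b\<in>J. E a b * f1 a b) + (\<Sum>a\<in>I. \<Sum>b\<in>J. E a b * f2 a b) / 4
      + (\<Sum>a\<in>I. \<Sum>b\<in>J. E a b * f3 a b) / 4" for f1 f2 f3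
      by (simp add: distrib_left sum.distrib sum_divide_distrib)
    have "y = (\<Sum>a\<in>I. \<Sum>b\<in>J. E a b * ((\<Sum>A\<in>P. c (u a) A * c (v b) A) / q\<^sup>2))
       + (\<Sum>a\<in>I. \<Sum>b\<in>J. E a b * (\<Sum>A\<in>P. (4 * (g (u a) A - c (u a) A) / q) * (g (v b) A / q))) / 4
       + (\<Sum>a\<in>I. \<Sum>b\<in>J. E a b * (\<Sum>A\<in>P. (c (u a) A / q) * (4 * (g (v b) A - c (v b) A) / q))) / 4"
      unfolding y split by (rule lin)
    then show ?thesis using main rem1 rem2 by linarith
  qed
  have "gram_forms E I J \<noteq> {}" using assms(2) by blast
  \<comment> \<open>Hence \<open>S \<le> 8 * B\<close>: the two remainders, each at most a quarter
    of \<open>S\<close>, are absorbed on the left.\<close>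
  then have "S \<le> 4 * B + S / 2"
    unfolding S_def by (rule cSup_least) (use step in \<open>simp add: S_def\<close>)
  with upper[OF assms(2)] show ?thesis by linarith
qed

text \<open>Scaling reduces to the unit ball. Vectors outside \<open>I\<close> and \<open>J\<close>
  are set to 0, since \<open>gram_forms\<close> constrains all of them, and radius 0 is treated
  apart because it cannot be scaled.\<close>

theorem Grothendieck_inequality:
  fixes E :: "'a \<Rightarrow> 'b \<Rightarrow> real" and u :: "'a \<Rightarrow> 'c \<Rightarrow> real" and v :: "'b \<Rightarrow> 'c \<Rightarrow> real"
  assumes signs: "\<And>s t. range s \<subseteq> {-1, 1} \<Longrightarrow> range t \<subseteq> {-1, 1} \<Longrightarrow>
      (\<Sum>a\<in>I. \<Sum>b\<in>J. E a b * (s a * t b)) \<le> B"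
    and "finite K" "\<alpha> \<ge> 0" "\<beta> \<ge> 0"
    and u: "\<And>a. a \<in> I \<Longrightarrow> (\<Sum>j\<in>K. (u a j)\<^sup>2) \<le> \<alpha>\<^sup>2"
    and v: "\<And>b. b \<in> J \<Longrightarrow> (\<Sum>j\<in>K. (v b j)\<^sup>2) \<le> \<beta>\<^sup>2"
  shows "(\<Sum>a\<in>I. \<Sum>b\<in>J. E a b * (\<Sum>j\<in>K. u a j * v b j)) \<le> 8 * \<alpha> * \<beta> * B"
proof (cases "\<alpha> = 0 \<or> \<beta> = 0")
  case True
  have "u a j * v b j = 0" if "a \<in> I" "b \<in> J" "j \<in> K" for a b j
    using True
  proof
    assume "\<alpha> = 0"
    then have "(\<Sum>j\<in>K. (u a j)\<^sup>2) = 0"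
      using u[OF that(1)] sum_nonneg[of K "\<lambda>j. (u a j)\<^sup>2"] by simp
    then show ?thesis using that \<open>finite K\<close> by (simp add: sum_nonneg_eq_0_iff)
  next
    assume "\<beta> = 0"
    then have "(\<Sum>j\<in>K. (v b j)\<^sup>2) = 0"
      using v[OF that(2)] sum_nonneg[of K "\<lambda>j. (v b j)\<^sup>2"] by simp
    then show ?thesis using that \<open>finite K\<close> by (simp add: sum_nonneg_eq_0_iff)
  qed
  then show ?thesis using True by auto
next
  case False
  then have pos: "\<alpha> > 0" "\<beta> > 0" using assms by auto
  define u' where "u' a j = (if a \<in> I then u a j / \<alpha> else 0)" for a j
  define v' where "v' b j = (if b \<in> J then v b j / \<beta> else 0)" for b j
  have "(\<Sum>j\<in>K. (u' a j)\<^sup>2) \<le> 1" for a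
    using u[of a] pos by (cases "a \<in> I") (auto simp: u'_def power_divide simp flip: sum_divide_distrib)
  moreover have "(\<Sum>j\<in>K. (v' b j)\<^sup>2) \<le> 1" for b
    using v[of b] pos by (cases "b \<in> J") (auto simp: v'_def power_divide simp flip: sum_divide_distrib)
  ultimately have "(\<Sum>a\<in>I. \<Sum>b\<in>J. E a b * (\<Sum>j\<in>K. u' a j * v' b j)) \<le> 8 * B"
    using gram_forms_le[OF signs] gram_formsI[OF \<open>finite K\<close>] by blast
  moreover have "(\<Sum>a\<in>I. \<Sum>b\<in>J. E a b * (\<Sum>j\<in>K. u' a j * v' b j)) =
      (\<Sum>a\<in>I. \<Sum>b\<in>J. E a b * (\<Sum>j\<in>K. u a j * v b j)) / (\<alpha> * \<beta>)"
    unfolding sum_divide_distrib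
    by (intro sum.cong refl) (simp add: u'_def v'_def flip: sum_divide_distrib)
  ultimately show ?thesis
    using pos by (simp add: field_simps)
qed

subsection \<open>Symmetrization, contraction and maxima of Rademacher sums\<close>

lemma expectation_mono_finite:
  fixes f g :: "'a \<Rightarrow> real"
  assumes "finite (set_pmf p)" "\<And>x. x \<in> set_pmf p \<Longrightarrow> f x \<le> g x"
  shows "measure_pmf.expectation p f \<le> measure_pmf.expectation p g"
  by (intro integral_mono_AE integrable_measure_pmf_finite assms AE_pmfI)

lemma expectation_bind_finite:
  fixes h :: "'b \<Rightarrow> real"
  assumes "finite (set_pmf p)" "\<And>x. x \<in> set_pmf p \<Longrightarrow> finite (set_pmf (f x))"
  shows "measure_pmf.expectation (p \<bind> f) h = measure_pmf.expectation p (\<lambda>x. measure_pmf.expectation (f x) h)"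
  using assms
  by (simp add: pmf_expectation_bind[of "set_pmf p"] integral_measure_pmf[of "set_pmf p"])

lemma expectation_swap_finite:
  fixes h :: "'a \<Rightarrow> 'b \<Rightarrow> real"
  assumes "finite (set_pmf p)" "finite (set_pmf q)"
  shows "measure_pmf.expectation p (\<lambda>x. measure_pmf.expectation q (h x)) =
    measure_pmf.expectation q (\<lambda>y. measure_pmf.expectation p (\<lambda>x. h x y))"
  using assms
  by (simp add: integral_measure_pmf[of "set_pmf p"] integral_measure_pmf[of "set_pmf q"]
      sum_distrib_left mult.left_commute) (rule sum.swap)

lemma finite_set_replicate_pmf:
  "finite (set_pmf p) \<Longrightarrow> finite (set_pmf (replicate_pmf n p))"
  by (induction n) auto

lemma expectation_replicate_pmf_Suc:
  fixes h :: "'a list \<Rightarrow> real"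
  assumes "finite (set_pmf p)"
  shows "measure_pmf.expectation (replicate_pmf (Suc n) p) h =
    measure_pmf.expectation p (\<lambda>x. measure_pmf.expectation (replicate_pmf n p) (\<lambda>xs. h (x # xs)))"
  using assms by (simp add: expectation_bind_finite finite_set_replicate_pmf)

definition signed_pmf :: "'a pmf \<Rightarrow> ('a \<times> real) pmf" where
  "signed_pmf p = pair_pmf p (pmf_of_set {-1, 1})"

lemma finite_set_signed_pmf: "finite (set_pmf p) \<Longrightarrow> finite (set_pmf (signed_pmf p))"
  by (simp add: signed_pmf_def)

lemma set_signed_pmf: "set_pmf (signed_pmf p) = set_pmf p \<times> {-1, 1}"
  by (simp add: signed_pmf_def)

lemma expectation_signed_pmf:
  assumes "finite (set_pmf p)"
  shows "measure_pmf.expectation (signed_pmf p) h =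
    measure_pmf.expectation p (\<lambda>z. (h (z, 1) + h (z, -1)) / 2 :: real)"
  using assms
  by (simp add: signed_pmf_def pair_pmf_def expectation_bind_finite integral_pmf_of_set add.commute)

text \<open>The two maxima may sit at different points, hence a hypothesis on pairs.\<close>

lemma Max_image_add_le:
  fixes f g :: "'t \<Rightarrow> real"
  assumes "finite T" "T \<noteq> {}"
    and "\<And>s t. s \<in> T \<Longrightarrow> t \<in> T \<Longrightarrow> f s + g t \<le> c"
  shows "Max (f ` T) + Max (g ` T) \<le> c"
proof -
  have "Max (f ` T) \<in> f ` T" "Max (g ` T) \<in> g ` T"
    using assms by (auto intro!: Max_in)
  then show ?thesis using assms(3) by auto
qed

text \<open>Averaging over \<open>h + 2 l(z')\<close> and \<open>h - 2 l(z)\<close> decouples \<open>z\<close> from its independent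
  copy \<open>z'\<close>; for a single observation the contraction principle is then just the triangle
  inequality.\<close>
lemma symmetrization_contraction_step:
  fixes l k :: "'t \<Rightarrow> 'z \<Rightarrow> real"
  assumes T: "finite T" "T \<noteq> {}" and p: "finite (set_pmf p)"
    and lip: "\<And>s t z. s \<in> T \<Longrightarrow> t \<in> T \<Longrightarrow> z \<in> set_pmf p \<Longrightarrow> \<bar>l s z - l t z\<bar> \<le> \<bar>k s z - k t z\<bar>"
  shows "measure_pmf.expectation p (\<lambda>z. Max ((\<lambda>t. h t + (measure_pmf.expectation p (l t) - l t z)) ` T))
    \<le> measure_pmf.expectation (signed_pmf p) (\<lambda>(z, e). Max ((\<lambda>t. h t + 2 * e * k t z) ` T))"
proof -
  define A where "A z = Max ((\<lambda>t. h t + 2 * l t z) ` T)" for z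
  define B where "B z = Max ((\<lambda>t. h t - 2 * l t z) ` T)" for z
  have int: "integrable (measure_pmf p) f" for f :: "'z \<Rightarrow> real"
    using p by (rule integrable_measure_pmf_finite)
  have "Max ((\<lambda>t. h t + (measure_pmf.expectation p (l t) - l t z)) ` T)
      \<le> (measure_pmf.expectation p A + B z) / 2" for z
  proof -
    have "h t + (measure_pmf.expectation p (l t) - l t z) \<le> (measure_pmf.expectation p A + B z) / 2"
      if "t \<in> T" for t
    proof -
      \<comment> \<open>Jensen's inequality for the maximum introduces the independent copy.\<close>
      have "h t + 2 * measure_pmf.expectation p (l t) = measure_pmf.expectation p (\<lambda>z. h t + 2 * l t z)"
        by (simp add: int)
      also have "\<dots> \<le> measure_pmf.expectation p A"
        using T that by (intro expectation_mono_finite p) (auto simp: A_def intro!: Max_ge)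
      finally have "h t + 2 * measure_pmf.expectation p (l t) \<le> measure_pmf.expectation p A" .
      moreover have "h t - 2 * l t z \<le> B z"
        using T that by (auto simp: B_def intro!: Max_ge)
      ultimately show ?thesis by (simp add: field_simps)
    qed
    then show ?thesis using T by (intro Max.boundedI) auto
  qed
  then have "measure_pmf.expectation p (\<lambda>z. Max ((\<lambda>t. h t + (measure_pmf.expectation p (l t) - l t z)) ` T))
     \<le> measure_pmf.expectation p (\<lambda>z. (measure_pmf.expectation p A + B z) / 2)"
    by (intro expectation_mono_finite p)
  also have "\<dots> = measure_pmf.expectation p (\<lambda>z. (A z + B z) / 2)"
    by (simp add: int)
  also have "\<dots> \<le> measure_pmf.expectation p (\<lambda>z. (Max ((\<lambda>t. h t + 2 * 1 * k t z) ` T) + Max ((\<lambda>t. h t + 2 * -1 * k t z) ` T)) / 2)"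
  proof (intro expectation_mono_finite p divide_right_mono)
    fix z assume z: "z \<in> set_pmf p"
    show "A z + B z \<le> Max ((\<lambda>t. h t + 2 * 1 * k t z) ` T) + Max ((\<lambda>t. h t + 2 * -1 * k t z) ` T)"
      unfolding A_def B_def
    proof (rule Max_image_add_le[OF T])
      fix s t assume st: "s \<in> T" "t \<in> T"
      have ge: "h r + 2 * 1 * k r z \<le> Max ((\<lambda>t. h t + 2 * 1 * k t z) ` T)"
        "h r + 2 * -1 * k r z \<le> Max ((\<lambda>t. h t + 2 * -1 * k t z) ` T)" if "r \<in> T" for r
        using T that by (auto intro!: Max_ge)
      \<comment> \<open>\<open>lip\<close> bounds \<open>2 * (l s z - l t z)\<close> by
        \<open>2 * \<bar>k s z - k t z\<bar>\<close>; the sign of that difference decides which of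
        \<open>s\<close> and \<open>t\<close> is tested in which maximum.\<close>
      show "h s + 2 * l s z + (h t - 2 * l t z)
        \<le> Max ((\<lambda>t. h t + 2 * 1 * k t z) ` T) + Max ((\<lambda>t. h t + 2 * -1 * k t z) ` T)"
        using lip[OF st z] ge[OF st(1)] ge[OF st(2)] by linarith
    qed
  qed simp
  also have "\<dots> = measure_pmf.expectation (signed_pmf p) (\<lambda>(z, e). Max ((\<lambda>t. h t + 2 * e * k t z) ` T))"
    by (simp add: expectation_signed_pmf[OF p])
  finally show ?thesis .
qed

text \<open>The offset \<open>h\<close> is arbitrary in the induction: it absorbs the observation
  just split off and, once the two expectations are exchanged, the already signed remainder, which
  leaves a single observation for the one-step bound.\<close>

lemma symmetrization_contraction:
  fixes l k :: "'t \<Rightarrow> 'z \<Rightarrow> real"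
  assumes T: "finite T" "T \<noteq> {}" and p: "finite (set_pmf p)"
    and lip: "\<And>s t z. s \<in> T \<Longrightarrow> t \<in> T \<Longrightarrow> z \<in> set_pmf p \<Longrightarrow> \<bar>l s z - l t z\<bar> \<le> \<bar>k s z - k t z\<bar>"
  shows "measure_pmf.expectation (replicate_pmf n p)
      (\<lambda>S. Max ((\<lambda>t. h t + (\<Sum>z\<leftarrow>S. measure_pmf.expectation p (l t) - l t z)) ` T))
    \<le> measure_pmf.expectation (replicate_pmf n (signed_pmf p))
      (\<lambda>S. Max ((\<lambda>t. h t + (\<Sum>(z, e)\<leftarrow>S. 2 * e * k t z)) ` T))"
proof (induction n arbitrary: h)
  case 0
  then show ?case by simp
next
  case (Suc n)
  let ?q = "signed_pmf p"
  note q = finite_set_signed_pmf[OF p]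
  have "measure_pmf.expectation (replicate_pmf (Suc n) p)
      (\<lambda>S. Max ((\<lambda>t. h t + (\<Sum>z\<leftarrow>S. measure_pmf.expectation p (l t) - l t z)) ` T))
    = measure_pmf.expectation p (\<lambda>x. measure_pmf.expectation (replicate_pmf n p) (\<lambda>S.
        Max ((\<lambda>t. (h t + (measure_pmf.expectation p (l t) - l t x)) + (\<Sum>z\<leftarrow>S. measure_pmf.expectation p (l t) - l t z)) ` T)))"
    by (simp only: expectation_replicate_pmf_Suc[OF p] list.map sum_list.Cons add.assoc)
  also have "\<dots> \<le> measure_pmf.expectation p (\<lambda>x. measure_pmf.expectation (replicate_pmf n ?q) (\<lambda>S.
        Max ((\<lambda>t. (h t + (measure_pmf.expectation p (l t) - l t x)) + (\<Sum>(z, e)\<leftarrow>S. 2 * e * k t z)) ` T)))"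
    by (intro expectation_mono_finite p Suc.IH)
  also have "\<dots> = measure_pmf.expectation (replicate_pmf n ?q) (\<lambda>S. measure_pmf.expectation p (\<lambda>x.
        Max ((\<lambda>t. (h t + (measure_pmf.expectation p (l t) - l t x)) + (\<Sum>(z, e)\<leftarrow>S. 2 * e * k t z)) ` T)))"
    by (rule expectation_swap_finite) (auto intro: p q finite_set_replicate_pmf)
  also have "\<dots> = measure_pmf.expectation (replicate_pmf n ?q) (\<lambda>S. measure_pmf.expectation p (\<lambda>x.
        Max ((\<lambda>t. (h t + (\<Sum>(z, e)\<leftarrow>S. 2 * e * k t z)) + (measure_pmf.expectation p (l t) - l t x)) ` T)))"
    by (simp only: add_ac)
  also have "\<dots> \<le> measure_pmf.expectation (replicate_pmf n ?q) (\<lambda>S. measure_pmf.expectation ?q (\<lambda>(x, e).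
        Max ((\<lambda>t. (h t + (\<Sum>(z, e)\<leftarrow>S. 2 * e * k t z)) + 2 * e * k t x) ` T)))"
    by (intro expectation_mono_finite finite_set_replicate_pmf q symmetrization_contraction_step T p lip)
  also have "\<dots> = measure_pmf.expectation ?q (\<lambda>x. measure_pmf.expectation (replicate_pmf n ?q) (\<lambda>S.
        case x of (x, e) \<Rightarrow> Max ((\<lambda>t. (h t + (\<Sum>(z, e)\<leftarrow>S. 2 * e * k t z)) + 2 * e * k t x) ` T)))"
    by (rule expectation_swap_finite) (auto intro: p q finite_set_replicate_pmf)
  also have "\<dots> = measure_pmf.expectation (replicate_pmf (Suc n) ?q)
      (\<lambda>S. Max ((\<lambda>t. h t + (\<Sum>(z, e)\<leftarrow>S. 2 * e * k t z)) ` T))"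
    unfolding expectation_replicate_pmf_Suc[OF q]
    by (simp add: case_prod_unfold add_ac)
  finally show ?case .
qed

section \<open>Exponential moments and maxima of signed sums\<close>

text \<open>Termwise comparison of power series, by
  \<open>2 ^ n * fact n \<le> fact (2 * n)\<close>.\<close>

lemma cosh_le_exp_half_sq: "cosh x \<le> exp (x\<^sup>2 / 2)" for x :: real
proof -
  have f: "2 ^ n * fact n \<le> (fact (2 * n) :: real)" for n
  proof (induction n)
    case (Suc n)
    have "2 ^ Suc n * fact (Suc n) = (2 * real (Suc n)) * (2 ^ n * fact n)"
      by (simp add: algebra_simps)
    also have "\<dots> \<le> (2 * real (Suc n)) * fact (2 * n)"
      by (intro mult_left_mono Suc.IH) auto
    also have "\<dots> \<le> (2 * real (Suc n)) * (real (2 * n + 1) * fact (2 * n))"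
      by (intro mult_left_mono mult_right_le_one_le) (auto simp: algebra_simps)
    also have "\<dots> = fact (2 * Suc n)"
      by (simp add: algebra_simps)
    finally show ?case .
  qed simp
  have "(\<lambda>n. if even n then x ^ n /\<^sub>R fact n else 0) sums cosh x"
    by (rule cosh_converges)
  then have lhs: "(\<lambda>n. x ^ (2 * n) /\<^sub>R fact (2 * n)) sums cosh x"
    using sums_mono_reindex[of "\<lambda>n. 2 * n" "\<lambda>n. if even n then x ^ n /\<^sub>R fact n else 0" "cosh x"]
    by (force simp: strict_mono_def elim!: evenE)
  have rhs: "(\<lambda>n. (x\<^sup>2 / 2) ^ n /\<^sub>R fact n) sums exp (x\<^sup>2 / 2)"
    by (rule exp_converges)
  have "x ^ (2 * n) /\<^sub>R fact (2 * n) \<le> (x\<^sup>2 / 2) ^ n /\<^sub>R fact n" for n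
  proof -
    have scale: "a /\<^sub>R b = a / b" for a b :: real by (simp add: divide_inverse)
    have "(x\<^sup>2 / 2) ^ n / fact n = x ^ (2 * n) / (2 ^ n * fact n)"
      by (simp add: power_divide power_mult)
    moreover have "x ^ (2 * n) / fact (2 * n) \<le> x ^ (2 * n) / (2 ^ n * fact n)"
      by (intro divide_left_mono f) (auto simp: power_mult)
    ultimately show ?thesis unfolding scale by (rule ord_le_eq_trans[OF _ sym, rotated])
  qed
  then show ?thesis
    by (rule sums_le[OF _ lhs rhs])
qed

text \<open>Given the observation, averaging over its sign turns its factor into
  \<open>cosh (\<mu> * c z)\<close>; independence multiplies \<open>n\<close> such factors.\<close>

lemma expectation_exp_signed_sum_le:
  fixes c :: "'z \<Rightarrow> real" and \<mu> :: real
  assumes p: "finite (set_pmf p)" and c: "\<And>z. z \<in> set_pmf p \<Longrightarrow> \<bar>c z\<bar> = 1"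
  shows "measure_pmf.expectation (replicate_pmf n (signed_pmf p)) (\<lambda>S. exp (\<mu> * (\<Sum>(z, e)\<leftarrow>S. e * c z)))
    \<le> exp (n * \<mu>\<^sup>2 / 2)"
proof (induction n)
  case 0
  then show ?case by simp
next
  case (Suc n)
  let ?q = "signed_pmf p"
  note q = finite_set_signed_pmf[OF p]
  let ?X = "measure_pmf.expectation (replicate_pmf n ?q) (\<lambda>S. exp (\<mu> * (\<Sum>(z, e)\<leftarrow>S. e * c z)))"
  have "measure_pmf.expectation (replicate_pmf (Suc n) ?q) (\<lambda>S. exp (\<mu> * (\<Sum>(z, e)\<leftarrow>S. e * c z)))
     = measure_pmf.expectation ?q (\<lambda>x. exp (\<mu> * (snd x * c (fst x))) * ?X)"
    unfolding expectation_replicate_pmf_Suc[OF q]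
    by (simp add: case_prod_unfold distrib_left exp_add)
  also have "\<dots> = measure_pmf.expectation p (\<lambda>z. (exp (\<mu> * c z) + exp (- (\<mu> * c z))) / 2 * ?X)"
    unfolding expectation_signed_pmf[OF p]
    by (intro arg_cong[where f = "measure_pmf.expectation p"] ext) (simp add: field_simps)
  also have "\<dots> \<le> measure_pmf.expectation p (\<lambda>z. exp (\<mu>\<^sup>2 / 2) * exp (n * \<mu>\<^sup>2 / 2))"
  proof (intro expectation_mono_finite p mult_mono Suc.IH)
    fix z assume "z \<in> set_pmf p"
    then have "(c z)\<^sup>2 = 1" using c by (metis power2_abs power_one)
    then show "(exp (\<mu> * c z) + exp (- (\<mu> * c z))) / 2 \<le> exp (\<mu>\<^sup>2 / 2)"
      using cosh_le_exp_half_sq[of "\<mu> * c z"] by (simp add: cosh_field_def power_mult_distrib)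
  qed (auto intro!: Bochner_Integration.integral_nonneg)
  also have "\<dots> = exp (Suc n * \<mu>\<^sup>2 / 2)"
    by (simp add: exp_add[symmetric] algebra_simps add_divide_distrib)
  finally show ?case .
qed

lemma expectation_Max_signed_sum_le:
  fixes c :: "'j \<Rightarrow> 'z \<Rightarrow> real"
  assumes p: "finite (set_pmf p)" and J: "finite J" "J \<noteq> {}"
    and c: "\<And>j z. j \<in> J \<Longrightarrow> z \<in> set_pmf p \<Longrightarrow> \<bar>c j z\<bar> = 1" and "\<mu> > 0"
  shows "measure_pmf.expectation (replicate_pmf n (signed_pmf p)) (\<lambda>S. Max ((\<lambda>j. \<Sum>(z, e)\<leftarrow>S. e * c j z) ` J))
    \<le> ln (card J) / \<mu> + n * \<mu> / 2"
proof -
  let ?r = "replicate_pmf n (signed_pmf p)"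
  let ?W = "\<lambda>j S. \<Sum>(z, e)\<leftarrow>S. e * c j z"
  have r: "finite (set_pmf ?r)"
    by (intro finite_set_replicate_pmf finite_set_signed_pmf p)
  have int: "integrable (measure_pmf ?r) f" for f :: "_ \<Rightarrow> real"
    using r by (rule integrable_measure_pmf_finite)
  \<comment> \<open>\<open>a\<close> bounds the expected sum of exponentials. Applying
    \<open>ln x \<le> x - 1\<close> to an exponential over \<open>a\<close> leaves, after
    expectation, \<open>1 - 1\<close> and \<open>ln a\<close>; \<open>\<mu>\<close> stays free for
    later balancing.\<close>
  define a :: real where "a = card J * exp (n * \<mu>\<^sup>2 / 2)"
  have cardJ: "real (card J) > 0" using J by (simp add: card_gt_0_iff)
  then have a: "a > 0" by (simp add: a_def)
  have pointwise: "Max ((\<lambda>j. ?W j S) ` J) \<le> ((\<Sum>j\<in>J. exp (\<mu> * ?W j S)) / a + ln a - 1) / \<mu>" for S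
  proof -
    have "?W i S \<le> ((\<Sum>j\<in>J. exp (\<mu> * ?W j S)) / a + ln a - 1) / \<mu>" if "i \<in> J" for i
    proof -
      have "\<mu> * ?W i S - ln a = ln (exp (\<mu> * ?W i S) / a)"
        using a by (simp add: ln_div)
      also have "\<dots> \<le> exp (\<mu> * ?W i S) / a - 1"
        using a by (intro ln_le_minus_one) auto
      also have "\<dots> \<le> (\<Sum>j\<in>J. exp (\<mu> * ?W j S)) / a - 1"
        using a J that by (intro diff_right_mono divide_right_mono member_le_sum) auto
      finally show ?thesis using \<open>\<mu> > 0\<close> by (simp add: field_simps)
    qed
    then show ?thesis using J by simp
  qed
  have "measure_pmf.expectation ?r (\<lambda>S. Max ((\<lambda>j. ?W j S) ` J))
     \<le> measure_pmf.expectation ?r (\<lambda>S. ((\<Sum>j\<in>J. exp (\<mu> * ?W j S)) / a + ln a - 1) / \<mu>)"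
    by (intro expectation_mono_finite r pointwise)
  also have "\<dots> = ((\<Sum>j\<in>J. measure_pmf.expectation ?r (\<lambda>S. exp (\<mu> * ?W j S))) / a + ln a - 1) / \<mu>"
    by (simp add: int)
  also have "\<dots> \<le> ((\<Sum>j\<in>J. exp (n * \<mu>\<^sup>2 / 2)) / a + ln a - 1) / \<mu>"
    using a \<open>\<mu> > 0\<close>
    by (intro divide_right_mono diff_right_mono add_right_mono sum_mono expectation_exp_signed_sum_le p c) auto
  also have "\<dots> = ln a / \<mu>"
    using cardJ by (simp add: a_def)
  also have "\<dots> = ln (card J) / \<mu> + n * \<mu> / 2"
    using cardJ \<open>\<mu> > 0\<close> by (simp add: a_def ln_mult field_simps power2_eq_square)
  finally show ?thesis .
qed

subsection \<open>Logistic loss and classification risk\<close>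

text \<open>Grothendieck's inequality bounds the form for each factorization, whatever its width;
  the bound passes to the infimum after division by \<open>8 * B\<close>. If \<open>B = 0\<close>,
  one factorization suffices.\<close>

lemma max_norm_dual_le:
  fixes E :: "nat \<Rightarrow> nat \<Rightarrow> real"
  assumes X: "X \<in> carrier_mat m k"
    and signs: "\<And>s t. range s \<subseteq> {-1, 1} \<Longrightarrow> range t \<subseteq> {-1, 1} \<Longrightarrow>
      (\<Sum>a<m. \<Sum>b<k. E a b * (s a * t b)) \<le> B"
  shows "(\<Sum>a<m. \<Sum>b<k. E a b * X $$ (a, b)) \<le> 8 * B * max_norm X"
proof -
  have factor: "(\<Sum>a<m. \<Sum>b<k. E a b * X $$ (a, b)) \<le> 8 * B * (two_inf_norm U * two_inf_norm V)"
    if U: "U \<in> carrier_mat m l" and V: "V \<in> carrier_mat k l" and UV: "X = U * V\<^sup>T" for U V l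
  proof -
    have "(\<Sum>a<m. \<Sum>b<k. E a b * X $$ (a, b)) =
        (\<Sum>a<m. \<Sum>b<k. E a b * (\<Sum>j<l. U $$ (a, j) * V $$ (b, j)))"
      unfolding UV using U V
      by (intro sum.cong refl) (auto simp: scalar_prod_def atLeast0LessThan)
    also have "\<dots> \<le> 8 * two_inf_norm U * two_inf_norm V * B"
      by (rule Grothendieck_inequality[OF signs])
        (use row_sum_sq_le_two_inf_norm[of _ U] row_sum_sq_le_two_inf_norm[of _ V] U V
          in \<open>auto simp: two_inf_norm_nonneg\<close>)
    finally show ?thesis by (simp add: mult_ac)
  qed
  have "(\<Sum>a<m. \<Sum>b<k. E a b * (1 * 1)) \<le> B" "(\<Sum>a<m. \<Sum>b<k. E a b * (-1 * 1)) \<le> B"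
    using signs[of "\<lambda>_. 1" "\<lambda>_. 1"] signs[of "\<lambda>_. -1" "\<lambda>_. 1"] by auto
  then have B: "B \<ge> 0" by (simp add: sum_negf)
  have XI: "X = X * (1\<^sub>m k)\<^sup>T" using X by simp
  show ?thesis
  proof (cases "B = 0")
    case True
    then show ?thesis using factor[OF X one_carrier_mat XI] by simp
  next
    case False
    with B have B: "B > 0" by simp
    have "(\<Sum>a<m. \<Sum>b<k. E a b * X $$ (a, b)) / (8 * B) \<le> max_norm X"
      unfolding max_norm_def
    proof (rule cInf_greatest)
      show "{two_inf_norm U * two_inf_norm V | U V l. U \<in> carrier_mat (dim_row X) l
          \<and> V \<in> carrier_mat (dim_col X) l \<and> X = U * V\<^sup>T} \<noteq> {}"
        using X XI one_carrier_mat by blast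
    qed (use X factor B in \<open>auto simp: field_simps\<close>)
    with B show ?thesis by (simp add: field_simps)
  qed
qed

text \<open>A pair stands for the rank-one matrix with entries \<open>s a * t b\<close>. Extensional
  functions keep the set finite.\<close>

definition sign_pairs :: "nat \<Rightarrow> nat \<Rightarrow> ((nat \<Rightarrow> real) \<times> (nat \<Rightarrow> real)) set" where
  "sign_pairs m k = ({..<m} \<rightarrow>\<^sub>E {-1, 1}) \<times> ({..<k} \<rightarrow>\<^sub>E {-1, 1})"

lemma finite_sign_pairs: "finite (sign_pairs m k)"
  by (auto simp: sign_pairs_def intro!: finite_cartesian_product finite_PiE)

lemma card_sign_pairs: "card (sign_pairs m k) = 2 ^ (m + k)"
  by (simp add: sign_pairs_def card_PiE power_add card_cartesian_product numeral_2_eq_2)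

lemma sign_pairs_nonempty: "sign_pairs m k \<noteq> {}"
  using card_sign_pairs[of m k] by force

text \<open>Grouping observations by index turns a sum along the sample into a form whose
  coefficients are the accumulated signs, the shape that duality asks for.\<close>

lemma sum_list_signed_eq_form:
  fixes f :: "nat \<times> nat \<Rightarrow> real"
  assumes "\<And>z e. (z, e) \<in> set S \<Longrightarrow> snd z \<in> {..<m} \<times> {..<k}"
  shows "(\<Sum>(z, e)\<leftarrow>S. e * f (snd z)) =
    (\<Sum>a<m. \<Sum>b<k. (\<Sum>(z, e)\<leftarrow>S. if snd z = (a, b) then e else 0) * f (a, b))"
  using assms
proof (induction S)
  case Nil
  then show ?case by simp
next
  case (Cons x S)
  obtain y i j e where x: "x = ((y, i, j), e)" by (metis prod.exhaust)
  have ij: "i < m" "j < k" using Cons.prems[of "(y, i, j)" e] x by auto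
  have "(\<Sum>a<m. \<Sum>b<k. (if (i, j) = (a, b) then e else 0) * f (a, b)) =
      (\<Sum>a<m. \<Sum>b<k. if a = i then if b = j then e * f (i, j) else 0 else 0)"
    by (intro sum.cong) auto
  also have "\<dots> = (\<Sum>a<m. if a = i then (\<Sum>b<k. if b = j then e * f (i, j) else 0) else 0)"
    by (intro sum.cong) auto
  also have "\<dots> = e * f (i, j)" using ij by simp
  finally show ?case
    using Cons.IH Cons.prems by (auto simp: x distrib_right sum.distrib)
qed

lemma signed_sum_le_max_norm:
  fixes S :: "(('y \<times> nat \<times> nat) \<times> real) list"
  assumes X: "X \<in> carrier_mat m k"
    and S: "\<And>z e. (z, e) \<in> set S \<Longrightarrow> snd z \<in> {..<m} \<times> {..<k}"
  shows "(\<Sum>(z, e)\<leftarrow>S. e * X $$ snd z)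
    \<le> 8 * max_norm X * Max ((\<lambda>(s, t). \<Sum>(z, e)\<leftarrow>S. e * (s (fst (snd z)) * t (snd (snd z)))) ` sign_pairs m k)"
proof -
  let ?E = "\<lambda>a b. \<Sum>(z, e)\<leftarrow>S. if snd z = (a, b) then e else 0"
  let ?W = "\<lambda>(s, t). \<Sum>(z, e)\<leftarrow>S. e * (s (fst (snd z)) * t (snd (snd z))) :: real"
  have W: "?W (s, t) = (\<Sum>a<m. \<Sum>b<k. ?E a b * (s a * t b))" for s t
    using sum_list_signed_eq_form[of S m k "\<lambda>w. s (fst w) * t (snd w)"] S by simp
  have signs: "(\<Sum>a<m. \<Sum>b<k. ?E a b * (s a * t b)) \<le> Max (?W ` sign_pairs m k)"
    if s: "range s \<subseteq> {-1, 1}" and t: "range t \<subseteq> {-1, 1}" for s t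
  proof -
    let ?s = "restrict s {..<m}" and ?t = "restrict t {..<k}"
    have "(\<Sum>a<m. \<Sum>b<k. ?E a b * (s a * t b)) = ?W (?s, ?t)"
      unfolding W by (intro sum.cong) auto
    moreover have "(?s, ?t) \<in> sign_pairs m k"
      using s t by (auto simp: sign_pairs_def)
    ultimately show ?thesis
      by (simp only:) (rule Max_ge[OF finite_imageI[OF finite_sign_pairs] imageI])
  qed
  have "(\<Sum>(z, e)\<leftarrow>S. e * X $$ snd z) = (\<Sum>a<m. \<Sum>b<k. ?E a b * X $$ (a, b))"
    using S by (rule sum_list_signed_eq_form)
  also have "\<dots> \<le> 8 * Max (?W ` sign_pairs m k) * max_norm X"
    using X signs by (rule max_norm_dual_le)
  also have "\<dots> = 8 * max_norm X * Max (?W ` sign_pairs m k)"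
    by (simp only: mult.assoc mult.commute[of "max_norm X"])
  finally show ?thesis .
qed

section \<open>Logistic likelihood and Kullback--Leibler divergence\<close>

definition label_loglik :: "int \<Rightarrow> real \<Rightarrow> real" where
  "label_loglik y x = (if y = 1 then ln (logistic x) else 0) + (if y = -1 then ln (1 - logistic x) else 0)"

lemma loglik_eq: "loglik X S = (\<Sum>z\<leftarrow>S. label_loglik (fst z) (X $$ snd z))"
  by (simp add: loglik_def label_loglik_def case_prod_unfold)

lemma logistic_bounds: "0 < logistic x" "logistic x < 1"
  by (simp_all add: logistic_def add_pos_pos divide_less_eq)

lemma ln_logistic: "ln (logistic x) = x - ln (1 + exp x)" "ln (1 - logistic x) = - ln (1 + exp x)"
proof -
  have pos: "1 + exp x > 0" by (simp add: add_pos_pos)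
  then show "ln (logistic x) = x - ln (1 + exp x)"
    by (simp add: logistic_def ln_div)
  have "1 - logistic x = 1 / (1 + exp x)"
    using pos by (simp add: logistic_def field_simps)
  then show "ln (1 - logistic x) = - ln (1 + exp x)"
    using pos by (simp add: ln_div)
qed

lemma logistic_ge_half_iff: "logistic x \<ge> 1 / 2 \<longleftrightarrow> x \<ge> 0"
proof -
  have "1 + exp x > 0" by (simp add: add_pos_pos)
  then have "logistic x \<ge> 1 / 2 \<longleftrightarrow> exp x \<ge> exp 0" by (simp add: logistic_def field_simps)
  then show ?thesis by (simp only: exp_le_cancel_iff)
qed

lemma logistic_eq_half_iff: "logistic x = 1 / 2 \<longleftrightarrow> x = 0"
proof -
  have "1 + exp x > 0" by (simp add: add_pos_pos)
  then have "logistic x = 1 / 2 \<longleftrightarrow> exp x = exp 0" by (auto simp: logistic_def field_simps)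
  then show ?thesis by (simp only: exp_inj_iff)
qed

text \<open>Both \<open>ln (1 + exp x)\<close> and \<open>x - ln (1 + exp x)\<close> are
  nondecreasing with slope at most 1; any other label gives 0.\<close>

lemma label_loglik_lipschitz: "\<bar>label_loglik y a - label_loglik y b\<bar> \<le> \<bar>a - b\<bar>"
proof -
  have incr: "ln (1 + exp a) \<le> ln (1 + exp b) \<and> ln (1 + exp b) \<le> ln (1 + exp a) + (b - a)"
    if "a \<le> b" for a b :: real
  proof
    show "ln (1 + exp a) \<le> ln (1 + exp b)" using that by (simp add: add_pos_pos)
    have "1 + exp b \<le> exp (b - a) * (1 + exp a)"
      using that by (simp add: distrib_left flip: exp_add)
    then have "ln (1 + exp b) \<le> ln (exp (b - a) * (1 + exp a))"
      by (subst ln_le_cancel_iff) (auto simp: add_pos_pos)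
    also have "\<dots> = (b - a) + ln (1 + exp a)"
      using exp_gt_zero[of a] by (subst ln_mult) (auto simp del: exp_gt_zero)
    finally show "ln (1 + exp b) \<le> ln (1 + exp a) + (b - a)" by simp
  qed
  show ?thesis
    using incr[of a b] incr[of b a] by (cases "a \<le> b") (auto simp: label_loglik_def ln_logistic)
qed

text \<open>Divergence dominates the squared Hellinger distance, by \<open>ln x \<le> x - 1\<close>
  at a quotient of square roots; the latter dominates \<open>(p - q)\<^sup>2 / 4\<close> once for
  each label, since two square roots add up to at most 2.\<close>

lemma bernoulli_KL_ge:
  fixes p q :: real
  assumes "0 < p" "p < 1" "0 < q" "q < 1"
  shows "(p - q)\<^sup>2 / 2 \<le> p * (ln p - ln q) + (1 - p) * (ln (1 - p) - ln (1 - q))"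
proof -
  have hellinger: "2 * (x - sqrt x * sqrt y) \<le> x * (ln x - ln y)" if "0 < x" "0 < y" for x y :: real
  proof -
    have "ln (sqrt y / sqrt x) \<le> sqrt y / sqrt x - 1"
      using that by (intro ln_le_minus_one) auto
    then have "ln y - ln x \<le> 2 * (sqrt y / sqrt x - 1)"
      using that by (simp add: ln_div ln_sqrt)
    then have "x * (ln y - ln x) \<le> x * (2 * (sqrt y / sqrt x - 1))"
      using that by (intro mult_left_mono) auto
    also have "\<dots> = 2 * (sqrt x * sqrt y - x)"
      using that by (simp add: algebra_simps real_div_sqrt flip: times_divide_eq_right)
        (simp add: real_div_sqrt field_simps)
    finally show ?thesis by (simp add: algebra_simps)
  qed
  have quarter: "(x - y)\<^sup>2 / 4 \<le> (sqrt x - sqrt y)\<^sup>2" if "0 < x" "x < 1" "0 < y" "y < 1" for x y :: real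
  proof -
    have "x - y = (sqrt x - sqrt y) * (sqrt x + sqrt y)"
      using that by (simp add: algebra_simps)
    then have "(x - y)\<^sup>2 = (sqrt x - sqrt y)\<^sup>2 * (sqrt x + sqrt y)\<^sup>2"
      by (simp only: power_mult_distrib)
    also have "\<dots> \<le> (sqrt x - sqrt y)\<^sup>2 * 2\<^sup>2"
    proof -
      have "sqrt x \<le> 1" "sqrt y \<le> 1" using that by auto
      then have "sqrt x + sqrt y \<le> 2" by linarith
      then show ?thesis using that by (intro mult_left_mono power_mono) auto
    qed
    finally show ?thesis by simp
  qed
  have "(p - q)\<^sup>2 / 2 = (p - q)\<^sup>2 / 4 + ((1 - p) - (1 - q))\<^sup>2 / 4"
    by (simp add: power2_eq_square field_simps)
  also have "\<dots> \<le> (sqrt p - sqrt q)\<^sup>2 + (sqrt (1 - p) - sqrt (1 - q))\<^sup>2"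
    using assms by (intro add_mono quarter) auto
  also have "\<dots> = 2 * (p - sqrt p * sqrt q) + 2 * ((1 - p) - sqrt (1 - p) * sqrt (1 - q))"
    using assms by (simp add: power2_diff algebra_simps)
  also have "\<dots> \<le> p * (ln p - ln q) + (1 - p) * (ln (1 - p) - ln (1 - q))"
    using assms by (intro add_mono hellinger) auto
  finally show ?thesis .
qed

lemma finite_idx_set: "finite (idx_set m k)"
  by (simp add: idx_set_def)

lemma idx_set_nonempty: "m \<ge> 1 \<Longrightarrow> k \<ge> 1 \<Longrightarrow> idx_set m k \<noteq> {}"
  by (auto simp: idx_set_def)

lemma set_obs_pmf:
  assumes "m \<ge> 1" "k \<ge> 1" "z \<in> set_pmf (obs_pmf m k Xs)"
  shows "snd z \<in> idx_set m k"
  using assms by (auto simp: obs_pmf_def set_pmf_of_set[OF idx_set_nonempty finite_idx_set])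

lemma finite_set_obs_pmf: "m \<ge> 1 \<Longrightarrow> k \<ge> 1 \<Longrightarrow> finite (set_pmf (obs_pmf m k Xs))"
  by (auto simp: obs_pmf_def set_pmf_of_set[OF idx_set_nonempty finite_idx_set] finite_idx_set)

lemma expectation_obs_pmf:
  fixes h :: "int \<times> nat \<times> nat \<Rightarrow> real"
  assumes "m \<ge> 1" "k \<ge> 1"
  shows "measure_pmf.expectation (obs_pmf m k Xs) h =
    (\<Sum>w\<in>idx_set m k. logistic (Xs $$ w) * h (1, w) + (1 - logistic (Xs $$ w)) * h (-1, w)) / card (idx_set m k)"
proof -
  have inner: "measure_pmf.expectation (bernoulli_pmf (logistic (Xs $$ w)) \<bind> (\<lambda>b. return_pmf (if b then 1 else -1, w))) h
     = logistic (Xs $$ w) * h (1, w) + (1 - logistic (Xs $$ w)) * h (-1, w)" for w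
    using logistic_bounds[of "Xs $$ w"]
    by (simp add: expectation_bind_finite)
  show ?thesis
    unfolding obs_pmf_def using assms
    by (subst expectation_bind_finite)
      (auto simp: inner set_pmf_of_set[OF idx_set_nonempty finite_idx_set] finite_idx_set
        integral_pmf_of_set[OF idx_set_nonempty finite_idx_set])
qed

lemma risk_eq_expectation:
  "risk m k Xs \<eta> = measure_pmf.expectation (obs_pmf m k Xs) (\<lambda>(y, w). of_bool (y \<noteq> \<eta> w))"
proof -
  have "(\<lambda>(y, w). of_bool (y \<noteq> \<eta> w)) = (indicator {(y, w). y \<noteq> \<eta> w} :: _ \<Rightarrow> real)"
    by (auto simp: indicator_def)
  then show ?thesis by (simp add: risk_def)
qed

text \<open>A wrong sign at an index with \<open>Xs \<noteq> 0\<close> costs \<open>|2p - 1|\<close>, and moves \<open>q\<close> across \<open>1/2\<close>,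
  so the Kullback--Leibler divergence is at least of order \<open>|p - 1/2|\<^sup>2 \<ge> |p - 1/2| / (2c)\<close>.\<close>
lemma pointwise_excess_le_KL:
  fixes a b c :: real
  assumes "c > 0" and ln: "a = 0 \<or> 1 / (2 * c) \<le> \<bar>logistic a - 1 / 2\<bar>"
  shows "(logistic a * of_bool (1 \<noteq> sign_pm b) + (1 - logistic a) * of_bool (-1 \<noteq> sign_pm b))
    - (logistic a * of_bool (1 \<noteq> sign_pm a) + (1 - logistic a) * of_bool (-1 \<noteq> sign_pm a))
    \<le> 8 * c * (logistic a * (label_loglik 1 a - label_loglik 1 b)
        + (1 - logistic a) * (label_loglik (-1) a - label_loglik (-1) b))"
    (is "?lhs \<le> 8 * c * ?KL")
proof -
  define p q where "p = logistic a" and "q = logistic b"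
  have KL: "(p - q)\<^sup>2 / 2 \<le> ?KL"
    using bernoulli_KL_ge[of p q] logistic_bounds
    by (simp add: p_def q_def label_loglik_def)
  have KL0: "0 \<le> ?KL" using KL zero_le_power2[of "p - q"] by linarith
  show ?thesis
  proof (cases "a = 0 \<or> sign_pm a = sign_pm b")
    case True
    \<comment> \<open>At \<open>a = 0\<close> both labels have probability 1/2, so every sign has
      the same error; this covers the indices that low noise leaves open.\<close>
    then have "?lhs = 0"
      using logistic_eq_half_iff[of a] by (auto simp: sign_pm_def)
    then show ?thesis using KL0 \<open>c > 0\<close> by simp
  next
    case False
    then have ab: "a \<noteq> 0" "sign_pm a \<noteq> sign_pm b" by auto
    have "?lhs \<le> 2 * \<bar>p - 1 / 2\<bar>"
      using abs_ge_self[of "p - 1 / 2"] abs_ge_minus_self[of "p - 1 / 2"]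
      by (cases "0 \<le> a"; cases "0 \<le> b") (simp_all add: sign_pm_def flip: p_def)
    \<comment> \<open>The inserted factor 1 contains \<open>1 / (2 * c)\<close>, which low noise
      bounds by a second \<open>\<bar>p - 1 / 2\<bar>\<close>; this produces the square and the
      constant \<open>8 * c\<close>.\<close>
    also have "\<dots> = 2 * \<bar>p - 1 / 2\<bar> * (2 * c * (1 / (2 * c)))"
      using \<open>c > 0\<close> by simp
    also have "\<dots> \<le> 2 * \<bar>p - 1 / 2\<bar> * (2 * c * \<bar>p - 1 / 2\<bar>)"
      using ln ab \<open>c > 0\<close> by (intro mult_left_mono) (auto simp: p_def)
    also have "\<dots> = 8 * c * (\<bar>p - 1 / 2\<bar>\<^sup>2 / 2)"
      by (simp add: power2_eq_square)
    also have "\<dots> \<le> 8 * c * (\<bar>p - q\<bar>\<^sup>2 / 2)"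
    proof -
      have "\<bar>p - 1 / 2\<bar> \<le> \<bar>p - q\<bar>"
        using ab logistic_ge_half_iff[of a] logistic_ge_half_iff[of b]
        by (auto simp: p_def q_def sign_pm_def split: if_splits)
      then show ?thesis using \<open>c > 0\<close> by (intro mult_left_mono divide_right_mono power_mono) auto
    qed
    also have "\<dots> \<le> 8 * c * ?KL"
      using KL \<open>c > 0\<close> by (intro mult_left_mono) auto
    finally show ?thesis .
  qed
qed

text \<open>The uniform distribution charges every index, so an event of probability 0 contains none
  of them.\<close>

lemma low_noiseD:
  assumes "m \<ge> 1" "k \<ge> 1" "low_noise c m k Xs" "w \<in> idx_set m k"
  shows "Xs $$ w = 0 \<or> 1 / (2 * c) \<le> \<bar>logistic (Xs $$ w) - 1 / 2\<bar>"
proof -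
  have "w \<in> set_pmf (pmf_of_set (idx_set m k))"
    using assms by (simp add: set_pmf_of_set[OF idx_set_nonempty finite_idx_set])
  then have "\<not> (0 < \<bar>logistic (Xs $$ w) - 1/2\<bar> \<and> \<bar>logistic (Xs $$ w) - 1/2\<bar> < 1 / (2 * c))"
    using assms(3) by (auto simp: low_noise_def measure_pmf_zero_iff)
  then show ?thesis
    using logistic_eq_half_iff[of "Xs $$ w"] by (cases "Xs $$ w = 0") (simp_all only: simp_thms, linarith)
qed

text \<open>Oriented so that its mean under \<open>obs_pmf\<close> is the average divergence, while
  its sum over the sample is nonpositive at a maximum likelihood estimator with which
  \<open>Xs\<close> competes.\<close>

definition excess_loss :: "real mat \<Rightarrow> real mat \<Rightarrow> int \<times> nat \<times> nat \<Rightarrow> real" where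
  "excess_loss Xs X z = label_loglik (fst z) (Xs $$ snd z) - label_loglik (fst z) (X $$ snd z)"

lemma excess_risk_le_excess_loss:
  assumes "m \<ge> 1" "k \<ge> 1" "c > 0" "low_noise c m k Xs"
  shows "risk m k Xs (\<lambda>w. sign_pm (X $$ w)) - risk m k Xs (\<lambda>w. sign_pm (Xs $$ w))
    \<le> 8 * c * measure_pmf.expectation (obs_pmf m k Xs) (excess_loss Xs X)"
proof -
  let ?I = "idx_set m k"
  let ?err = "\<lambda>X w. logistic (Xs $$ w) * of_bool (1 \<noteq> sign_pm (X $$ w))
    + (1 - logistic (Xs $$ w)) * of_bool (-1 \<noteq> sign_pm (X $$ w)) :: real"
  let ?KL = "\<lambda>w. logistic (Xs $$ w) * excess_loss Xs X (1, w) + (1 - logistic (Xs $$ w)) * excess_loss Xs X (-1, w)"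
  have "risk m k Xs (\<lambda>w. sign_pm (X $$ w)) - risk m k Xs (\<lambda>w. sign_pm (Xs $$ w))
     = (\<Sum>w\<in>?I. ?err X w - ?err Xs w) / card ?I"
    unfolding risk_eq_expectation expectation_obs_pmf[OF assms(1,2)]
    by (simp add: sum_subtractf diff_divide_distrib)
  also have "\<dots> \<le> (\<Sum>w\<in>?I. 8 * c * ?KL w) / card ?I"
    unfolding excess_loss_def fst_conv snd_conv
    by (intro divide_right_mono sum_mono pointwise_excess_le_KL low_noiseD[OF assms(1,2,4)] assms(3)) auto
  also have "\<dots> = 8 * c * measure_pmf.expectation (obs_pmf m k Xs) (excess_loss Xs X)"
    unfolding expectation_obs_pmf[OF assms(1,2)] by (simp flip: sum_distrib_left)
  finally show ?thesis .
qed

section \<open>Uniform deviation and the rate\<close>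

lemma expectation_max_norm_process_le:
  assumes "m \<ge> 1" "k \<ge> 1" "n \<ge> 1" and R: "R \<ge> 0"
    and T: "finite T" "T \<noteq> {}" "\<And>X. X \<in> T \<Longrightarrow> X \<in> carrier_mat m k \<and> max_norm X \<le> R"
  shows "measure_pmf.expectation (replicate_pmf n (signed_pmf (obs_pmf m k Xs)))
      (\<lambda>S. Max ((\<lambda>X. \<Sum>(z, e)\<leftarrow>S. 2 * e * X $$ snd z) ` T)) \<le> 32 * R * sqrt (real (m + k) * real n)"
proof -
  let ?p = "obs_pmf m k Xs" and ?J = "sign_pairs m k"
  let ?r = "replicate_pmf n (signed_pmf ?p)"
  let ?c = "\<lambda>j z. fst j (fst (snd z)) * snd j (snd (snd z)) :: real"
  let ?M = "\<lambda>S. Max ((\<lambda>j. \<Sum>(z, e)\<leftarrow>S. e * ?c j z) ` ?J)"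
  note p = finite_set_obs_pmf[OF assms(1,2), of Xs]
  have r: "finite (set_pmf ?r)"
    by (intro finite_set_replicate_pmf finite_set_signed_pmf p)
  have pointwise: "Max ((\<lambda>X. \<Sum>(z, e)\<leftarrow>S. 2 * e * X $$ snd z) ` T) \<le> 16 * R * ?M S"
    if S: "S \<in> set_pmf ?r" for S
  proof -
    have in_idx: "snd z \<in> {..<m} \<times> {..<k}" if "(z, e) \<in> set S" for z e
    proof -
      have "z \<in> set_pmf ?p"
        using S that by (auto simp: set_replicate_pmf set_signed_pmf lists_eq_set)
      then show ?thesis
        using set_obs_pmf[OF assms(1,2), of z Xs] by (simp add: idx_set_def atLeast0LessThan)
    qed
    \<comment> \<open>Negating \<open>s\<close> negates the sum, so the maximum is nonnegative; this
      allows \<open>max_norm X\<close> to be replaced by \<open>R\<close> as its factor.\<close>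
    have M0: "0 \<le> ?M S"
    proof -
      let ?s = "\<lambda>_::nat. 1 :: real"
      let ?j = "(restrict ?s {..<m}, restrict ?s {..<k})" and ?j' = "(restrict (\<lambda>_. -1) {..<m}, restrict ?s {..<k})"
      have mem: "?j \<in> ?J" "?j' \<in> ?J" by (auto simp: sign_pairs_def)
      have "?c ?j' z = - ?c ?j z" if "(z, e) \<in> set S" for z e
        using in_idx[OF that] by auto
      then have "(\<Sum>(z, e)\<leftarrow>S. e * ?c ?j' z) = (\<Sum>(z, e)\<leftarrow>S. - (e * ?c ?j z))"
        by (intro arg_cong[where f = sum_list] map_cong) auto
      also have "\<dots> = - (\<Sum>(z, e)\<leftarrow>S. e * ?c ?j z)"
        by (simp add: case_prod_unfold uminus_sum_list_map o_def)
      finally have "(\<Sum>(z, e)\<leftarrow>S. e * ?c ?j' z) = - (\<Sum>(z, e)\<leftarrow>S. e * ?c ?j z)" .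
      moreover have "(\<Sum>(z, e)\<leftarrow>S. e * ?c ?j z) \<le> ?M S" "(\<Sum>(z, e)\<leftarrow>S. e * ?c ?j' z) \<le> ?M S"
        by (rule Max_ge; use finite_sign_pairs mem in blast)+
      ultimately show ?thesis by linarith
    qed
    have "(\<Sum>(z, e)\<leftarrow>S. 2 * e * X $$ snd z) \<le> 16 * R * ?M S" if X: "X \<in> T" for X
    proof -
      have "(\<Sum>(z, e)\<leftarrow>S. 2 * e * X $$ snd z) = 2 * (\<Sum>(z, e)\<leftarrow>S. e * X $$ snd z)"
        by (simp add: case_prod_unfold mult.assoc sum_list_const_mult)
      also have "\<dots> \<le> 2 * (8 * max_norm X * ?M S)"
        using signed_sum_le_max_norm[of X m k S] T(3)[OF X] in_idx by (simp add: case_prod_unfold)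
      also have "\<dots> = 16 * max_norm X * ?M S" by simp
      also have "\<dots> \<le> 16 * R * ?M S"
        using T(3)[OF X] M0 by (intro mult_right_mono) auto
      finally show ?thesis .
    qed
    then show ?thesis using T(1,2) by (intro Max.boundedI) auto
  qed
  define d where "d = real (m + k)"
  have d: "d > 0" using assms by (simp add: d_def)
  \<comment> \<open>Balances \<open>d / \<mu>\<close> against \<open>n * \<mu>\<close>: both become
    \<open>sqrt (d * n)\<close>, with total factor 3/2.\<close>
  define \<mu> where "\<mu> = sqrt d / sqrt n"
  have \<mu>: "\<mu> > 0" using d assms(3) by (simp add: \<mu>_def)
  have "measure_pmf.expectation ?r (\<lambda>S. Max ((\<lambda>X. \<Sum>(z, e)\<leftarrow>S. 2 * e * X $$ snd z) ` T))
     \<le> measure_pmf.expectation ?r (\<lambda>S. 16 * R * ?M S)"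
    by (intro expectation_mono_finite r pointwise)
  also have "\<dots> = 16 * R * measure_pmf.expectation ?r ?M"
    by simp
  also have "\<dots> \<le> 16 * R * (ln (card ?J) / \<mu> + n * \<mu> / 2)"
  proof (intro mult_left_mono expectation_Max_signed_sum_le p finite_sign_pairs sign_pairs_nonempty \<mu>)
    fix j z assume "j \<in> ?J" "z \<in> set_pmf ?p"
    then have "\<bar>fst j (fst (snd z))\<bar> = 1" "\<bar>snd j (snd (snd z))\<bar> = 1"
      using set_obs_pmf[OF assms(1,2), of z Xs] by (auto simp: sign_pairs_def idx_set_def PiE_iff) force+
    then show "\<bar>?c j z\<bar> = 1" by (simp add: abs_mult)
  qed (use R in auto)
  also have "\<dots> \<le> 16 * R * (d / \<mu> + n * \<mu> / 2)"
  proof -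
    have "ln (real (card ?J)) = d * ln 2"
      by (simp add: card_sign_pairs ln_realpow d_def)
    also have "\<dots> \<le> d * 1"
      using d ln_2_less_1 by (intro mult_left_mono) auto
    finally show ?thesis
      using R \<mu> by (intro mult_left_mono add_right_mono divide_right_mono) auto
  qed
  also have "d / \<mu> = sqrt (d * n)"
    using d by (simp add: \<mu>_def real_sqrt_mult real_div_sqrt field_simps)
  also have "n * \<mu> = sqrt (d * n)"
    using assms(3) by (simp add: \<mu>_def real_sqrt_mult real_div_sqrt field_simps)
  also have "16 * R * (sqrt (d * n) + sqrt (d * n) / 2) \<le> 32 * R * sqrt (d * n)"
    using R d by (simp add: algebra_simps)
  finally show ?thesis by (simp add: d_def)
qed

text \<open>As the empirical excess loss is nonpositive, \<open>n\<close> times the mean loss is at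
  most a centred sum at \<open>Xhat S\<close>; a maximum over a class fixed in advance removes the
  dependence of the estimator on the sample.\<close>

lemma expected_excess_loss_le:
  assumes "m \<ge> 1" "k \<ge> 1" "n \<ge> 1" and R: "R \<ge> 0"
    and Xhat: "\<And>S. Xhat S \<in> carrier_mat m k \<and> max_norm (Xhat S) \<le> R"
    and mle: "\<And>S. loglik Xs S \<le> loglik (Xhat S) S"
  shows "measure_pmf.expectation (sample_pmf m k n Xs)
      (\<lambda>S. measure_pmf.expectation (obs_pmf m k Xs) (excess_loss Xs (Xhat S)))
    \<le> 32 * R * sqrt (real (m + k) * real n) / n"
proof -
  let ?p = "obs_pmf m k Xs" and ?r = "sample_pmf m k n Xs"
  note p = finite_set_obs_pmf[OF assms(1,2), of Xs]
  have r: "finite (set_pmf ?r)"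
    unfolding sample_pmf_def by (intro finite_set_replicate_pmf p)
  let ?L = "\<lambda>X. measure_pmf.expectation ?p (excess_loss Xs X)"
  define T where "T = Xhat ` set_pmf ?r"
  have T: "finite T" "T \<noteq> {}" using r by (auto simp: T_def set_pmf_not_empty)
  \<comment> \<open>The summand 0 is the offset \<open>h\<close> of the symmetrization
    bound.\<close>
  have "n * ?L (Xhat S) \<le> Max ((\<lambda>X. 0 + (\<Sum>z\<leftarrow>S. ?L X - excess_loss Xs X z)) ` T)"
    if S: "S \<in> set_pmf ?r" for S
  proof -
    have len: "length S = n" using S by (simp add: sample_pmf_def set_replicate_pmf)
    have "(\<Sum>z\<leftarrow>S. excess_loss Xs (Xhat S) z) = loglik Xs S - loglik (Xhat S) S"
      by (simp add: loglik_eq excess_loss_def sum_list_subtractf)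
    also have "\<dots> \<le> 0" using mle[of S] by simp
    finally have "n * ?L (Xhat S) \<le> (\<Sum>z\<leftarrow>S. ?L (Xhat S) - excess_loss Xs (Xhat S) z)"
      by (simp add: sum_list_subtractf sum_list_triv len)
    also have "\<dots> \<le> Max ((\<lambda>X. 0 + (\<Sum>z\<leftarrow>S. ?L X - excess_loss Xs X z)) ` T)"
      using T S by (intro Max_ge) (auto simp: T_def)
    finally show ?thesis .
  qed
  then have "measure_pmf.expectation ?r (\<lambda>S. n * ?L (Xhat S)) \<le> measure_pmf.expectation ?r (\<lambda>S.
      Max ((\<lambda>X. 0 + (\<Sum>z\<leftarrow>S. ?L X - excess_loss Xs X z)) ` T))"
    by (intro expectation_mono_finite r)
  also have "\<dots> \<le> measure_pmf.expectation (replicate_pmf n (signed_pmf ?p))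
      (\<lambda>S. Max ((\<lambda>X. 0 + (\<Sum>(z, e)\<leftarrow>S. 2 * e * X $$ snd z)) ` T))"
    unfolding sample_pmf_def
  proof (rule symmetrization_contraction[OF T p])
    fix X Y z
    show "\<bar>excess_loss Xs X z - excess_loss Xs Y z\<bar> \<le> \<bar>X $$ snd z - Y $$ snd z\<bar>"
      using label_loglik_lipschitz[of "fst z" "X $$ snd z" "Y $$ snd z"] by (simp add: excess_loss_def)
  qed
  also have "\<dots> \<le> 32 * R * sqrt (real (m + k) * real n)"
    unfolding add_0 using Xhat
    by (intro expectation_max_norm_process_le assms T) (auto simp: T_def)
  finally show ?thesis
    using \<open>n \<ge> 1\<close> by (simp add: field_simps)
qed

theorem theorem2:
  fixes \<gamma> c :: real
  assumes "\<gamma> > 0" and "c > 0"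
  shows "\<exists>C > 0. \<forall>(m1::nat) (m2::nat) (n::nat) (Xs::real mat)
            (Xhat :: (int \<times> (nat \<times> nat)) list \<Rightarrow> real mat).
     m1 \<ge> 1 \<longrightarrow> m2 \<ge> 1 \<longrightarrow> n \<ge> 1 \<longrightarrow>
     Xs \<in> carrier_mat m1 m2 \<longrightarrow> sup_norm Xs \<le> \<gamma> \<longrightarrow> low_noise c m1 m2 Xs \<longrightarrow>
     (\<forall>S. Xhat S \<in> K_max \<gamma> (real (matrix_rank Xs)) m1 m2 \<and>
          (\<forall>X \<in> K_max \<gamma> (real (matrix_rank Xs)) m1 m2. loglik X S \<le> loglik (Xhat S) S)) \<longrightarrow>
     excess_risk m1 m2 n Xs Xhat
       \<le> C * sqrt (real (matrix_rank Xs) * real (m1 + m2) / real n)"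
proof (intro exI[of _ "256 * c * \<gamma>"] conjI allI impI)
  show "0 < 256 * c * \<gamma>" using assms by simp
  fix m1 m2 n :: nat and Xs :: "real mat" and Xhat :: "(int \<times> (nat \<times> nat)) list \<Rightarrow> real mat"
  assume m: "1 \<le> m1" "1 \<le> m2" and n: "1 \<le> n" and Xs: "Xs \<in> carrier_mat m1 m2"
    and sup: "sup_norm Xs \<le> \<gamma>" and noise: "low_noise c m1 m2 Xs"
    and mle: "\<forall>S. Xhat S \<in> K_max \<gamma> (real (matrix_rank Xs)) m1 m2 \<and>
          (\<forall>X \<in> K_max \<gamma> (real (matrix_rank Xs)) m1 m2. loglik X S \<le> loglik (Xhat S) S)"
  let ?r = "sample_pmf m1 m2 n Xs"
  define R where "R = \<gamma> * sqrt (matrix_rank Xs)"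
  have fin: "finite (set_pmf ?r)"
    unfolding sample_pmf_def by (intro finite_set_replicate_pmf finite_set_obs_pmf m)
  have int: "integrable (measure_pmf ?r) f" for f :: "_ \<Rightarrow> real"
    using fin by (rule integrable_measure_pmf_finite)
  have XsK: "Xs \<in> K_max \<gamma> (real (matrix_rank Xs)) m1 m2"
    using max_norm_le_sqrt_rank[OF Xs m(1) _ sup] Xs sup assms(1) by (simp add: K_max_def)
  have "excess_risk m1 m2 n Xs Xhat = measure_pmf.expectation ?r (\<lambda>S.
      risk m1 m2 Xs (\<lambda>w. sign_pm (Xhat S $$ w)) - risk m1 m2 Xs (\<lambda>w. sign_pm (Xs $$ w)))"
    by (simp add: excess_risk_def int)
  also have "\<dots> \<le> measure_pmf.expectation ?r (\<lambda>S.
      8 * c * measure_pmf.expectation (obs_pmf m1 m2 Xs) (excess_loss Xs (Xhat S)))"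
    by (intro expectation_mono_finite fin excess_risk_le_excess_loss m assms noise)
  also have "\<dots> = 8 * c * measure_pmf.expectation ?r (\<lambda>S.
      measure_pmf.expectation (obs_pmf m1 m2 Xs) (excess_loss Xs (Xhat S)))"
    by simp
  also have "\<dots> \<le> 8 * c * (32 * R * sqrt (real (m1 + m2) * real n) / n)"
    using mle XsK assms
    by (intro mult_left_mono expected_excess_loss_le m n) (auto simp: K_max_def R_def)
  also have "\<dots> = 256 * c * \<gamma> * (sqrt (matrix_rank Xs) * sqrt (m1 + m2) * (sqrt n / n))"
    by (simp add: R_def real_sqrt_mult)
  also have "sqrt n / n = 1 / sqrt n"
    using n by (simp add: real_div_sqrt field_simps)
  also have "sqrt (matrix_rank Xs) * sqrt (m1 + m2) * (1 / sqrt n)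
      = sqrt (real (matrix_rank Xs) * real (m1 + m2) / real n)"
    by (simp add: real_sqrt_mult real_sqrt_divide)
  finally show "excess_risk m1 m2 n Xs Xhat
       \<le> 256 * c * \<gamma> * sqrt (real (matrix_rank Xs) * real (m1 + m2) / real n)" .
qed

end
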